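(* Let $p=p(n)\in[0,1]$ be a function of the positive integer $n$ with $p=o(1)$ as $n\to\infty$. Then with high probability $G\sim G(n,p)$ is Class 1, i.e. $\Pr[\chi'(G)=\Delta(G)]\to 1$ as $n\to\infty$.
   Context: $G(n,p)$ is the binomial random graph: the vertex set is $[n]=\{1,\dots,n\}$ and each of the $\binom n2$ possible edges is included independently with probability $p$. $\chi'(G)$ is the chromatic index of $G$, i.e. the minimum $k$ such that there is a function $c:E(G)\to[k]$ with $c(e)\ne c(f)$ whenever distinct edges $e,f$ share a vertex. $\Delta(G)$ is the maximum degree. A simple graph $G$ is Class 1 if $\chi'(G)=\Delta(G)$. An event holds with high probability if its probability tends to $1$ as $n\to\infty$. *)

theory Defs
  imports "HOL-Probability.Probability" "HOL-Library.Landau_Symbols"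
begin

text \<open>A simple graph is a pair of a vertex set and an edge set, the edges being two-element sets of
  vertices.\<close>

type_synonym 'a graph = "'a set \<times> 'a set set"

definition verts :: "'a graph \<Rightarrow> 'a set" where
  "verts G = fst G"

definition edges :: "'a graph \<Rightarrow> 'a set set" where
  "edges G = snd G"

definition vertex_degree :: "'a graph \<Rightarrow> 'a \<Rightarrow> nat" where
  "vertex_degree G v = card {e \<in> edges G. v \<in> e}"

text \<open>Unspecified (\<open>Max {}\<close>) for the graph without vertices.\<close>

definition max_degree :: "'a graph \<Rightarrow> nat" where
  "max_degree G = Max (vertex_degree G ` verts G)"

definition proper_edge_colouring :: "'a graph \<Rightarrow> nat \<Rightarrow> ('a set \<Rightarrow> nat) \<Rightarrow> bool" where
  "proper_edge_colouring G k c \<longleftrightarrow>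
     c ` edges G \<subseteq> {1..k} \<and>
     (\<forall>e\<in>edges G. \<forall>f\<in>edges G. e \<noteq> f \<and> e \<inter> f \<noteq> {} \<longrightarrow> c e \<noteq> c f)"

definition chromatic_index :: "'a graph \<Rightarrow> nat" where
  "chromatic_index G = (LEAST k. \<exists>c. proper_edge_colouring G k c)"

definition class_1 :: "'a graph \<Rightarrow> bool" where
  "class_1 G \<longleftrightarrow> chromatic_index G = max_degree G"

definition possible_edges :: "nat \<Rightarrow> nat set set" where
  "possible_edges n = {e. e \<subseteq> {1..n} \<and> card e = 2}"

text \<open>The indicators of the possible edges are independent Bernoulli variables of parameter \<open>p\<close>;
  \<open>False\<close> is only the default value of \<open>Pi_pmf\<close> outside of \<open>possible_edges n\<close>.\<close>

definition gnp :: "nat \<Rightarrow> real \<Rightarrow> nat graph pmf" where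
  "gnp n p = map_pmf (\<lambda>\<omega>. ({1..n}, {e \<in> possible_edges n. \<omega> e}))
     (Pi_pmf (possible_edges n) False (\<lambda>_. bernoulli_pmf p))"

end

theory Submission
  imports Defs "HOL-Real_Asymp.Real_Asymp"
begin

text \<open>
The argument rests on Fournier's theorem: a graph is Class 1 unless some non-empty set \<open>S\<close> of
vertices of maximum degree has the property that each of its members has two neighbours in
\<open>S\<close>. Hence a graph that is not Class 1 has two adjacent vertices of maximum degree, and also a
non-empty vertex set spanning at least as many edges as it has vertices
(\<open>not_class_1_obstructions\<close>). Depending on the size of \<open>n * p\<close>, one or the other is
unlikely in the random graph.

If \<open>n * p\<close> is small, then a union bound excludes the dense vertex set
(\<open>prob_dense_set\<close>).

Otherwise a switching argument excludes adjacent vertices \<open>u\<close>, \<open>v\<close> of maximum degree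
\<open>\<Delta>\<close> (\<open>prob_adjacent_core\<close>). Delete the edge between them, join \<open>u\<close> to two further
vertices and \<open>v\<close> to another two. Then \<open>u\<close> and \<open>v\<close> have degree \<open>\<Delta> + 1\<close>, and at
most six vertices have this degree. So the switch can be performed in about \<open>n ^ 4\<close> ways, but the
result arises in at most \<open>36 * (\<Delta> + 1) ^ 4\<close> ways. As three edges are gained, the probability of
a given graph changes by a factor of about \<open>p ^ 3\<close>. Altogether the event has probability of order
\<open>(\<Delta> + 1) ^ 4 / (p ^ 3 * n ^ 4)\<close>, which is \<open>p * ((\<Delta> + 1) / (n * p)) ^ 4\<close>. With high
probability \<open>\<Delta>\<close> is of order at most \<open>n * p + ln n\<close> (\<open>prob_max_degree_ge\<close>), so the bound
becomes a multiple of \<open>p + ln n ^ 4 / (n * (n * p) ^ 3)\<close>. The first term is where the assumption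
that \<open>p\<close> tends to zero enters.

Fournier's theorem is proved by adding one vertex at a time, following Schrijver's proof of Vizing's
theorem. The new edges at a vertex \<open>v\<close> need distinct colours, each missing at the other end. Kempe
exchanges even out how often the colours are available at the neighbours of \<open>v\<close>, until a parity
argument finds a colour that is available, among the colours listed, at just one neighbour
(\<open>colour_free_at_one_vertex\<close>); that colour is used there and set aside.
\<close>

section \<open>Kempe exchanges\<close>

definition deg :: "'a set set \<Rightarrow> 'a \<Rightarrow> nat" where
  "deg E x = card {e \<in> E. x \<in> e}"

definition proper :: "'a set set \<Rightarrow> nat set \<Rightarrow> ('a set \<Rightarrow> nat) \<Rightarrow> bool" where
  "proper E C c \<longleftrightarrow> c ` E \<subseteq> C \<and> (\<forall>e\<in>E. \<forall>f\<in>E. e \<noteq> f \<and> e \<inter> f \<noteq> {} \<longrightarrow> c e \<noteq> c f)"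

definition used :: "'a set set \<Rightarrow> ('a set \<Rightarrow> nat) \<Rightarrow> 'a \<Rightarrow> nat set" where
  "used E c x = c ` {e \<in> E. x \<in> e}"

definition closed_under :: "'a set set \<Rightarrow> 'a set \<Rightarrow> bool" where
  "closed_under H S \<longleftrightarrow> (\<forall>e\<in>H. e \<inter> S \<noteq> {} \<longrightarrow> e \<subseteq> S)"

lemma handshake:
  assumes "finite S" "finite H" "\<And>e. e \<in> H \<Longrightarrow> e \<subseteq> S \<and> card e = 2"
  shows "(\<Sum>x\<in>S. deg H x) = 2 * card H"
proof -
  have "card {x \<in> S. x \<in> e} = 2" if "e \<in> H" for e
  proof -
    have "{x \<in> S. x \<in> e} = e" using assms(3)[OF that] by auto
    then show ?thesis using assms(3)[OF that] by simp
  qed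
  then show ?thesis
    unfolding deg_def using assms(1,2) by (intro sum_multicount) auto
qed

lemma finite_Union_edges:
  assumes "finite H" "\<And>e. e \<in> H \<Longrightarrow> card e = 2"
  shows "finite (\<Union>H)"
proof (rule finite_Union[OF assms(1)])
  show "finite e" if "e \<in> H" for e using assms(2)[OF that] card.infinite[of e] by linarith
qed

text \<open>Components of a graph of maximum degree two are paths and cycles. Instead of following a walk, take a
largest set \<open>S\<close> around \<open>u\<close> that spans at least \<open>card S - 1\<close>
edges. It is closed, since a neighbour outside could be added, and its degree sum is at least
\<open>2 * card S - 2\<close>, at most two short of all degrees being two.\<close>

lemma component_has_few_ends:
  assumes fin: "finite H" and two: "\<And>e. e \<in> H \<Longrightarrow> card e = 2" and deg2: "\<And>x. deg H x \<le> 2"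
  obtains S where "finite S" "u \<in> S" "closed_under H S" "card {x \<in> S. deg H x \<le> 1} \<le> 2"
proof -
  define U where "U = insert u (\<Union>H)"
  have finU: "finite U" unfolding U_def using finite_Union_edges[OF fin two] by simp
  \<comment> \<open>A spanning tree of the component of \<open>u\<close> would show that this component satisfies \<open>P\<close>.\<close>
  define P where "P S \<longleftrightarrow> u \<in> S \<and> S \<subseteq> U \<and> card S \<le> card {e \<in> H. e \<subseteq> S} + 1" for S
  have "P {u}" by (auto simp: P_def U_def)
  moreover have "\<forall>S. P S \<longrightarrow> card S < Suc (card U)"
    using card_mono[OF finU] unfolding P_def less_Suc_eq_le by blast
  ultimately have "\<exists>S. P S \<and> (\<forall>T. P T \<longrightarrow> card T \<le> card S)"
    by (rule Lattices_Big.ex_has_greatest_nat)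
  then obtain S where PS: "P S" and max: "\<And>T. P T \<Longrightarrow> card T \<le> card S" by auto
  have finS: "finite S" using PS finU finite_subset unfolding P_def by blast
  have cl: "closed_under H S"
    unfolding closed_under_def
  proof (intro ballI impI)
    fix e assume e: "e \<in> H" "e \<inter> S \<noteq> {}"
    show "e \<subseteq> S"
    proof (rule ccontr)
      assume ns: "\<not> e \<subseteq> S"
      then obtain b where b: "b \<in> e" "b \<notin> S" by auto
      obtain a where a: "a \<in> e" "a \<in> S" using e by auto
      have eab: "e = {a, b}"
        using two[OF e(1)] a b unfolding card_2_iff by auto
      let ?T = "insert b S"
      have "insert e {e \<in> H. e \<subseteq> S} \<subseteq> {e \<in> H. e \<subseteq> ?T}" using eab a e by auto
      then have "card (insert e {e \<in> H. e \<subseteq> S}) \<le> card {e \<in> H. e \<subseteq> ?T}"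
        using fin by (intro card_mono) auto
      moreover have "card (insert e {e \<in> H. e \<subseteq> S}) = Suc (card {e \<in> H. e \<subseteq> S})"
        using fin ns by (subst card_insert_disjoint) auto
      ultimately have "P ?T"
        using PS finS b e unfolding P_def U_def by auto
      from max[OF this] show False using finS b by simp
    qed
  qed
  let ?H = "{e \<in> H. e \<subseteq> S}"
  have "(\<Sum>x\<in>S. deg H x) = (\<Sum>x\<in>S. deg ?H x)"
  proof (rule sum.cong)
    fix x assume "x \<in> S"
    then have "{e \<in> H. x \<in> e} = {e \<in> ?H. x \<in> e}" using cl unfolding closed_under_def by auto
    then show "deg H x = deg ?H x" unfolding deg_def by metis
  qed simp
  also have "\<dots> = 2 * card ?H"
    using finS fin two by (intro handshake) auto
  finally have sum_eq: "(\<Sum>x\<in>S. deg H x) = 2 * card ?H" .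
  let ?L = "{x \<in> S. deg H x \<le> 1}"
  have "(\<Sum>x\<in>S. deg H x + (if deg H x \<le> 1 then 1 else 0)) \<le> (\<Sum>x\<in>S. 2)"
    using deg2 by (intro sum_mono) auto
  then have "(\<Sum>x\<in>S. deg H x) + card ?L \<le> 2 * card S"
    using finS by (simp add: sum.distrib sum.If_cases Int_def)
  then have "card ?L \<le> 2" using sum_eq PS unfolding P_def by linarith
  then show ?thesis using that finS cl PS unfolding P_def by blast
qed

text \<open>A smallest closed set \<open>T\<close> with more points of \<open>A\<close> than of \<open>B\<close> meets
a closed set with at most two ends. By minimality the part of \<open>T\<close> outside that set has no
surplus of \<open>A\<close>, so the part inside has one, and it is bounded by the number of ends.\<close>

lemma unbalanced_closed_set:
  assumes fin: "finite H" and two: "\<And>e. e \<in> H \<Longrightarrow> card e = 2" and deg2: "\<And>x. deg H x \<le> 2"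
    and finAB: "finite A" "finite B"
    and ends: "\<And>x. x \<in> A \<union> B \<Longrightarrow> deg H x \<le> 1"
    and less: "card B < card A"
  obtains S where "closed_under H S" "card (B \<inter> S) < card (A \<inter> S)"
    "card (A \<inter> S) \<le> card (B \<inter> S) + 2"
proof -
  define P where "P S \<longleftrightarrow> finite S \<and> closed_under H S \<and> card (B \<inter> S) < card (A \<inter> S)" for S
  have "finite (A \<union> B \<union> \<Union>H)" using finAB finite_Union_edges[OF fin two] by simp
  moreover have "A \<inter> (A \<union> B \<union> \<Union>H) = A" "B \<inter> (A \<union> B \<union> \<Union>H) = B" by auto
  ultimately have "P (A \<union> B \<union> \<Union>H)" using less unfolding P_def closed_under_def by auto
  then obtain T where PT: "P T" and min: "\<And>S. P S \<Longrightarrow> card T \<le> card S"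
    using ex_has_least_nat[of P _ card] by blast
  then have "A \<inter> T \<noteq> {}" unfolding P_def by auto
  then obtain u where u: "u \<in> T" by auto
  obtain S where S: "finite S" "u \<in> S" "closed_under H S" "card {x \<in> S. deg H x \<le> 1} \<le> 2"
    using component_has_few_ends[OF fin two deg2] by blast
  have split: "card (X \<inter> T) = card (X \<inter> (T \<inter> S)) + card (X \<inter> (T - S))" if "finite X" for X
    using that by (subst card_Un_disjoint [symmetric]) (auto intro: arg_cong[where f = card])
  have cl: "closed_under H (T \<inter> S)" "closed_under H (T - S)"
    using S(3) PT unfolding P_def closed_under_def by blast+
  have "card (T - S) < card T" using PT u S(2) unfolding P_def by (intro psubset_card_mono) auto
  then have "\<not> P (T - S)" using min by (meson not_le)
  then have "card (A \<inter> (T - S)) \<le> card (B \<inter> (T - S))"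
    using cl PT unfolding P_def by auto
  then have "card (B \<inter> (T \<inter> S)) < card (A \<inter> (T \<inter> S))"
    using split[OF finAB(1)] split[OF finAB(2)] PT unfolding P_def by linarith
  moreover have "card (A \<inter> (T \<inter> S)) \<le> card {x \<in> S. deg H x \<le> 1}"
    using S ends by (intro card_mono) auto
  ultimately show ?thesis using that[OF cl(1)] S(4) by linarith
qed

text \<open>At each vertex either all edges of the two colours are exchanged or none is, because \<open>S\<close> is
closed. Edges of other colours may leave \<open>S\<close>, but the transposition fixes their colours.\<close>

lemma kempe_swap:
  assumes proper: "proper E C c" and ij: "i \<in> C" "j \<in> C" "i \<noteq> j"
    and cl: "closed_under {e \<in> E. c e \<in> {i, j}} S"
  defines "c' \<equiv> (\<lambda>e. if e \<inter> S \<noteq> {} then Transposition.transpose i j (c e) else c e)"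
  shows "proper E C c'"
    and "\<And>x. x \<in> S \<Longrightarrow> used E c' x = Transposition.transpose i j ` used E c x"
    and "\<And>x. x \<notin> S \<Longrightarrow> used E c' x = used E c x"
proof -
  have tr: "Transposition.transpose i j a \<in> C \<longleftrightarrow> a \<in> C" for a using ij by (auto simp: Transposition.transpose_def)
  have inS: "c' e = Transposition.transpose i j (c e)" if "e \<in> E" "x \<in> e" "x \<in> S" for e x
    using that unfolding c'_def by auto
  have notS: "c' e = c e" if "e \<in> E" "x \<in> e" "x \<notin> S" for e x
  proof (cases "c e \<in> {i, j}")
    case True
    then have "e \<inter> S = {}" using cl that unfolding closed_under_def by blast
    then show ?thesis unfolding c'_def by simp
  next
    case False
    then show ?thesis unfolding c'_def by (simp add: Transposition.transpose_def)
  qed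
  show "proper E C c'"
    unfolding proper_def
  proof (intro conjI ballI impI)
    show "c' ` E \<subseteq> C" using proper tr unfolding proper_def c'_def by auto
  next
    fix e f assume ef: "e \<in> E" "f \<in> E" "e \<noteq> f \<and> e \<inter> f \<noteq> {}"
    then obtain x where x: "x \<in> e" "x \<in> f" by auto
    have ne: "c e \<noteq> c f" using ef proper unfolding proper_def by blast
    show "c' e \<noteq> c' f"
    proof (cases "x \<in> S")
      case True
      then show ?thesis using inS[OF ef(1) x(1)] inS[OF ef(2) x(2)] ne by (metis transpose_involutory)
    next
      case False
      then show ?thesis using notS[OF ef(1) x(1)] notS[OF ef(2) x(2)] ne by simp
    qed
  qed
  show "used E c' x = Transposition.transpose i j ` used E c x" if "x \<in> S" for x
    unfolding used_def image_image using inS that by (intro image_cong) auto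
  show "used E c' x = used E c x" if "x \<notin> S" for x
    unfolding used_def using notS that by (intro image_cong) auto
qed

lemma deg_two_colours:
  assumes proper: "proper E C c" and "finite D"
  shows "deg {e \<in> E. c e \<in> D} x \<le> card (D \<inter> used E c x)"
proof -
  have "deg {e \<in> E. c e \<in> D} x = card (c ` {e \<in> {e \<in> E. c e \<in> D}. x \<in> e})"
    unfolding deg_def using proper
    by (intro card_image[symmetric]) (auto simp: inj_on_def proper_def)
  also have "\<dots> \<le> card (D \<inter> used E c x)"
    using \<open>finite D\<close> by (intro card_mono) (auto simp: used_def)
  finally show ?thesis .
qed

section \<open>Fournier's theorem\<close>

text \<open>The set \<open>N\<close> is meant as the neighbourhood of a vertex that is still to be added to the coloured
edge set \<open>E\<close>. The list \<open>M x\<close> may be any set of colours missing at \<open>x\<close>, not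
necessarily all of them, so that all lists can be cut down to a prescribed size.\<close>

definition free_lists :: "'a set set \<Rightarrow> nat set \<Rightarrow> 'a set \<Rightarrow> ('a \<Rightarrow> nat set) \<Rightarrow> ('a set \<Rightarrow> nat) \<Rightarrow> bool" where
  "free_lists E C N M c \<longleftrightarrow> proper E C c \<and> (\<forall>x\<in>N. M x \<subseteq> C - used E c x)"

text \<open>If colour \<open>i\<close> is on at least three more lists than colour \<open>j\<close>, then exchanging the two
colours on a suitable component moves the difference of the counts \<open>a\<close> of \<open>i\<close> and
\<open>b\<close> of \<open>j\<close> inwards: they become \<open>a - d\<close> and \<open>b + d\<close> with
\<open>d \<in> {1, 2}\<close>, and \<open>a - b \<ge> 3 > d\<close> makes the sum of squares drop. A vertex with
exactly one of the two colours on its list misses that colour, hence lies on at most one edge of the two colours.\<close>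

lemma balance_step:
  assumes fin: "finite E" "finite C" "finite N" and two: "\<And>e. e \<in> E \<Longrightarrow> card e = 2"
    and fl: "free_lists E C N M c"
    and ij: "i \<in> C" "j \<in> C"
    and gap: "card {x \<in> N. j \<in> M x} + 3 \<le> card {x \<in> N. i \<in> M x}"
  obtains M' c' where "free_lists E C N M' c'" "\<And>x. x \<in> N \<Longrightarrow> card (M' x) = card (M x)"
    "(\<Sum>l\<in>C. (card {x \<in> N. l \<in> M' x})\<^sup>2) < (\<Sum>l\<in>C. (card {x \<in> N. l \<in> M x})\<^sup>2)"
proof -
  define X where "X l = {x \<in> N. l \<in> M x}" for l
  have ne: "i \<noteq> j" using gap by auto
  have proper: "proper E C c" and Mu: "\<And>x. x \<in> N \<Longrightarrow> M x \<subseteq> C - used E c x"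
    using fl unfolding free_lists_def by auto
  define H where "H = {e \<in> E. c e \<in> {i, j}}"
  have degH: "deg H x \<le> card ({i, j} \<inter> used E c x)" for x
    unfolding H_def using deg_two_colours[OF proper, of "{i, j}"] by simp
  have deg2: "deg H x \<le> 2" for x
    using degH[of x] card_mono[of "{i, j}" "{i, j} \<inter> used E c x"] ne by auto
  have ends: "deg H x \<le> 1" if "x \<in> X i \<union> X j" for x
  proof -
    have "{i, j} \<inter> used E c x \<subseteq> {i} \<or> {i, j} \<inter> used E c x \<subseteq> {j}"
      using that Mu[of x] unfolding X_def by auto
    then have "card ({i, j} \<inter> used E c x) \<le> 1"
      by (elim disjE) (auto dest!: card_mono[rotated])
    then show ?thesis using degH[of x] by linarith
  qed
  have finX: "finite (X l)" for l using fin unfolding X_def by auto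
  have split: "card (X l) = card (X l \<inter> S) + card (X l - S)" for l S
    using finX by (subst card_Un_disjoint [symmetric]) (auto intro: arg_cong[where f = card])
  have gap': "card (X j) + 3 \<le> card (X i)" using gap unfolding X_def .
  define A where "A = X i - X j"
  define B where "B = X j - X i"
  have cA: "card (X i \<inter> S) = card (X i \<inter> X j \<inter> S) + card (A \<inter> S)" for S
    using finX unfolding A_def
    by (subst card_Un_disjoint [symmetric]) (auto intro: arg_cong[where f = card])
  have cB: "card (X j \<inter> S) = card (X i \<inter> X j \<inter> S) + card (B \<inter> S)" for S
    using finX unfolding B_def
    by (subst card_Un_disjoint [symmetric]) (auto intro: arg_cong[where f = card])
  \<comment> \<open>Vertices with both colours on their lists contribute equally to both counts and cancel.\<close>
  have "card B < card A" using cA[of UNIV] cB[of UNIV] gap' by simp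
  moreover have "finite H" "\<And>e. e \<in> H \<Longrightarrow> card e = 2" using fin two unfolding H_def by auto
  ultimately obtain S where S: "closed_under H S" "card (B \<inter> S) < card (A \<inter> S)"
    "card (A \<inter> S) \<le> card (B \<inter> S) + 2"
    using unbalanced_closed_set[of H A B] deg2 ends finX unfolding A_def B_def by blast
  define c' where "c' = (\<lambda>e. if e \<inter> S \<noteq> {} then Transposition.transpose i j (c e) else c e)"
  define M' where "M' x = (if x \<in> S then Transposition.transpose i j ` M x else M x)" for x
  define X' where "X' l = {x \<in> N. l \<in> M' x}" for l
  note swap = kempe_swap[OF proper ij ne S(1)[unfolded H_def], folded c'_def]
  have trC: "Transposition.transpose i j ` C = C" using ij by simp
  have fl': "free_lists E C N M' c'"
    unfolding free_lists_def
  proof (intro conjI ballI)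
    show "proper E C c'" by (rule swap(1))
    fix x assume x: "x \<in> N"
    show "M' x \<subseteq> C - used E c' x"
    proof (cases "x \<in> S")
      case True
      have "Transposition.transpose i j ` M x \<subseteq> Transposition.transpose i j ` (C - used E c x)" using Mu[OF x] by (rule image_mono)
      also have "\<dots> = C - used E c' x"
        using swap(2)[OF True] trC by (simp add: image_set_diff)
      finally show ?thesis using True by (simp add: M'_def)
    next
      case False
      then show ?thesis using Mu[OF x] swap(3)[OF False] by (simp add: M'_def)
    qed
  qed
  have card': "card (M' x) = card (M x)" for x
    unfolding M'_def by (simp add: card_image)
  have tri: "a \<in> Transposition.transpose i j ` Z \<longleftrightarrow> Transposition.transpose i j a \<in> Z" for a Z
    by (metis image_iff transpose_involutory)
  have X'i: "X' i = (X i - S) \<union> (X j \<inter> S)" and X'j: "X' j = (X j - S) \<union> (X i \<inter> S)"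
    unfolding X'_def M'_def X_def by (auto simp: tri)
  have X'l: "X' l = X l" if "l \<noteq> i" "l \<noteq> j" for l
    using that unfolding X'_def M'_def X_def by (auto simp: tri)
  have "card (X' i) = card (X i - S) + card (X j \<inter> S)"
    "card (X' j) = card (X j - S) + card (X i \<inter> S)"
    unfolding X'i X'j using finX by (auto intro!: card_Un_disjoint)
  moreover define d where "d = card (A \<inter> S) - card (B \<inter> S)"
  then have "card (A \<inter> S) = card (B \<inter> S) + d" "1 \<le> d" "d \<le> 2" using S(2,3) by linarith+
  ultimately have d: "card (X i) = card (X' i) + d" "card (X' j) = card (X j) + d" "1 \<le> d" "d \<le> 2"
    using cA[of S] cB[of S] split[of i S] split[of j S] by linarith+
  have "card (X j) + 3 \<le> card (X' i) + d" using gap' d by linarith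
  then have "card (X j) < card (X' i)" using d by linarith
  then have "d * card (X j) < d * card (X' i)" using d by simp
  then have sq: "(card (X' i))\<^sup>2 + (card (X' j))\<^sup>2 < (card (X i))\<^sup>2 + (card (X j))\<^sup>2"
  proof -
    have "(card (X i))\<^sup>2 = (card (X' i))\<^sup>2 + 2 * (d * card (X' i)) + d * d"
      "(card (X' j))\<^sup>2 = (card (X j))\<^sup>2 + 2 * (d * card (X j)) + d * d"
      unfolding d(1,2) by (simp_all add: power2_eq_square algebra_simps)
    then show ?thesis using \<open>d * card (X j) < d * card (X' i)\<close> by linarith
  qed
  have sum_split: "(\<Sum>l\<in>C. g l) = g i + g j + (\<Sum>l\<in>C - {i, j}. g l)" for g :: "nat \<Rightarrow> nat"
  proof -
    have "(\<Sum>l\<in>C. g l) = (\<Sum>l\<in>{i, j}. g l) + (\<Sum>l\<in>C - {i, j}. g l)"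
      using fin(2) ij by (subst sum.subset_diff[of "{i, j}"]) auto
    then show ?thesis using ne by simp
  qed
  have "(\<Sum>l\<in>C - {i, j}. (card (X' l))\<^sup>2) = (\<Sum>l\<in>C - {i, j}. (card (X l))\<^sup>2)"
    using X'l by (intro sum.cong) auto
  then have "(\<Sum>l\<in>C. (card (X' l))\<^sup>2) < (\<Sum>l\<in>C. (card (X l))\<^sup>2)"
    unfolding sum_split using sq by linarith
  then show ?thesis using that[OF fl'] card' unfolding X_def X'_def by blast
qed

text \<open>After minimising the sum of squares any two colours are on almost equally many lists, differing by
at most two. The list sizes sum to the odd number \<open>2 * card N - 1 < 2 * card C\<close>, so some colour
is on at most one list; if it is on none, then every colour is on at most two lists, and by parity
one of them is on exactly one.\<close>

lemma colour_free_at_one_vertex: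
  assumes fin: "finite E" "finite C" "finite N" and two: "\<And>e. e \<in> E \<Longrightarrow> card e = 2"
    and fl: "free_lists E C N M c" and z: "z \<in> N"
    and sizes: "\<And>x. x \<in> N \<Longrightarrow> card (M x) = (if x = z then 1 else 2)"
    and le: "card N \<le> card C"
  obtains M' c' i u where "free_lists E C N M' c'" "\<And>x. x \<in> N \<Longrightarrow> card (M' x) = card (M x)"
    "i \<in> C" "{x \<in> N. i \<in> M' x} = {u}"
proof -
  define Q where "Q = (\<lambda>(M', c'). free_lists E C N M' c' \<and> (\<forall>x\<in>N. card (M' x) = card (M x)))"
  define \<Phi> where "\<Phi> = (\<lambda>(M', c' :: 'a set \<Rightarrow> nat). \<Sum>l\<in>C. (card {x \<in> N. l \<in> M' x})\<^sup>2)"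
  have "Q (M, c)" using fl unfolding Q_def by auto
  then obtain s where s: "Q s" "\<And>t. Q t \<Longrightarrow> \<Phi> s \<le> \<Phi> t"
    using ex_has_least_nat[of Q _ \<Phi>] by blast
  obtain M' c' where s_eq: "s = (M', c')" by (cases s)
  have fl': "free_lists E C N M' c'" and card': "\<And>x. x \<in> N \<Longrightarrow> card (M' x) = card (M x)"
    using s(1) unfolding Q_def s_eq by auto
  define k where "k l = card {x \<in> N. l \<in> M' x}" for l
  have balanced: "k i \<le> k j + 2" if ij: "i \<in> C" "j \<in> C" for i j
  proof (rule ccontr)
    assume "\<not> k i \<le> k j + 2"
    then have gap: "card {x \<in> N. j \<in> M' x} + 3 \<le> card {x \<in> N. i \<in> M' x}" unfolding k_def by linarith
    show False
    proof (rule balance_step[OF fin two fl' ij gap])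
      fix M'' c''
      assume "free_lists E C N M'' c''" "\<And>x. x \<in> N \<Longrightarrow> card (M'' x) = card (M' x)"
        and lt: "(\<Sum>l\<in>C. (card {x \<in> N. l \<in> M'' x})\<^sup>2) < (\<Sum>l\<in>C. (card {x \<in> N. l \<in> M' x})\<^sup>2)"
      then have "Q (M'', c'')" using card' unfolding Q_def by auto
      from s(2)[OF this] show False using lt unfolding \<Phi>_def s_eq by simp
    qed auto
  qed
  have "(\<Sum>l\<in>C. k l) = (\<Sum>x\<in>N. card {l \<in> C. l \<in> M' x})"
    unfolding k_def using fin by (intro sum_multicount_gen) auto
  also have "\<dots> = (\<Sum>x\<in>N. if x = z then 1 else 2)"
  proof (rule sum.cong)
    fix x assume x: "x \<in> N"
    then have "{l \<in> C. l \<in> M' x} = M' x" using fl' unfolding free_lists_def by blast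
    then show "card {l \<in> C. l \<in> M' x} = (if x = z then 1 else 2)" using card' sizes x by simp
  qed simp
  also have "\<dots> = 1 + (\<Sum>x\<in>N - {z}. if x = z then 1 else 2)"
    by (subst sum.remove[OF fin(3) z]) simp
  also have "(\<Sum>x\<in>N - {z}. if x = z then 1 else 2) = (\<Sum>x\<in>N - {z}. 2 :: nat)"
    by (intro sum.cong) auto
  finally have total: "(\<Sum>l\<in>C. k l) + 1 = 2 * card N"
    using card.remove[OF fin(3) z] by simp
  have "\<exists>i\<in>C. k i = 1"
  proof (rule ccontr)
    assume none: "\<not> (\<exists>i\<in>C. k i = 1)"
    have "\<exists>i\<in>C. k i < 2"
    proof (rule ccontr)
      assume "\<not> (\<exists>i\<in>C. k i < 2)"
      then have "(\<Sum>l\<in>C. 2) \<le> (\<Sum>l\<in>C. k l)" by (intro sum_mono) auto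
      then show False using total le by simp
    qed
    then obtain i where i: "i \<in> C" "k i = 0" using none by (metis One_nat_def less_2_cases)
    have "even (k l)" if "l \<in> C" for l
    proof -
      have "k l \<le> 2" "k l \<noteq> 1" using balanced[OF that i(1)] i(2) none that by auto
      then have "k l = 0 \<or> k l = 2" by linarith
      then show ?thesis by auto
    qed
    then have "even (\<Sum>l\<in>C. k l)" by (rule dvd_sum)
    then show False using total by presburger
  qed
  then obtain i u where "i \<in> C" "{x \<in> N. i \<in> M' x} = {u}"
    unfolding k_def by (metis card_1_singletonE)
  then show ?thesis using that[OF fl' card'] by blast
qed

text \<open>A colour \<open>i\<close> on the list of a single vertex \<open>u\<close> can be reserved for \<open>u\<close>: no other
list changes when \<open>i\<close>, its colour class and \<open>u\<close> are set aside, and the remaining problem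
has one colour and one vertex less. One list of size one is tolerated throughout; cutting all lists
down so that exactly one has size one and the others two gives the odd total that the previous lemma
relies on.\<close>

lemma extend_to_star:
  assumes fin: "finite E" "finite C" "finite N" and two: "\<And>e. e \<in> E \<Longrightarrow> card e = 2"
    and fl: "free_lists E C N M c"
    and nonempty: "\<And>x. x \<in> N \<Longrightarrow> 1 \<le> card (M x)"
    and pairs: "\<And>x. x \<in> N \<Longrightarrow> x \<noteq> z \<Longrightarrow> 2 \<le> card (M x)"
    and le: "card N \<le> card C"
  shows "\<exists>c' f. proper E C c' \<and> inj_on f N \<and> (\<forall>x\<in>N. f x \<in> C - used E c' x)"
  using assms
proof (induction "card N" arbitrary: E C N M c z)
  case 0
  then show ?case by (intro exI[of _ c]) (auto simp: free_lists_def)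
next
  case (Suc m)
  note fin = Suc.prems(1-3) and two = Suc.prems(4)
  obtain z' where z': "z' \<in> N" "\<And>x. x \<in> N \<Longrightarrow> x \<noteq> z' \<Longrightarrow> 2 \<le> card (M x)"
  proof (cases "z \<in> N")
    case True
    then show ?thesis using that Suc.prems(7) by blast
  next
    case False
    then show ?thesis using that Suc.prems(7) Suc.hyps(2) by (metis card.empty equals0I nat.simps(3))
  qed
  have "\<exists>B. B \<subseteq> M x \<and> card B = (if x = z' then 1 else 2)" if "x \<in> N" for x
  proof -
    have "(if x = z' then 1 else 2) \<le> card (M x)" using Suc.prems(6)[OF that] z'(2)[OF that] by (cases "x = z'") auto
    then show ?thesis by (rule obtain_subset_with_card_n) blast
  qed
  then obtain M1 where M1: "\<And>x. x \<in> N \<Longrightarrow> M1 x \<subseteq> M x"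
    "\<And>x. x \<in> N \<Longrightarrow> card (M1 x) = (if x = z' then 1 else 2)" by metis
  have fl1: "free_lists E C N M1 c" using Suc.prems(5) M1(1) unfolding free_lists_def by blast
  obtain M2 c2 i u where fl2: "free_lists E C N M2 c2"
    and card2: "\<And>x. x \<in> N \<Longrightarrow> card (M2 x) = card (M1 x)"
    and i: "i \<in> C" and u: "{x \<in> N. i \<in> M2 x} = {u}"
    by (rule colour_free_at_one_vertex[OF fin two fl1 z'(1) M1(2) Suc.prems(8)]) (assumption | rule that)+
  \<comment> \<open>Colour \<open>i\<close> and its edges stay as they are; the recolouring happens in the rest.\<close>
  define E' where "E' = {e \<in> E. c2 e \<noteq> i}"
  have uN: "u \<in> N" "i \<in> M2 u" using u by auto
  have prop2: "proper E C c2" using fl2 unfolding free_lists_def by auto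
  have "free_lists E' (C - {i}) (N - {u}) M2 c2"
    unfolding free_lists_def
  proof (intro conjI ballI)
    show "proper E' (C - {i}) c2" using prop2 unfolding proper_def E'_def by auto
    fix x assume x: "x \<in> N - {u}"
    then have "i \<notin> M2 x" using u by auto
    moreover have "M2 x \<subseteq> C - used E c2 x" using fl2 x unfolding free_lists_def by auto
    ultimately show "M2 x \<subseteq> C - {i} - used E' c2 x" unfolding used_def E'_def by auto
  qed
  moreover have "m = card (N - {u})" "card (N - {u}) \<le> card (C - {i})"
    using Suc.hyps(2) Suc.prems(8) uN(1) i fin by auto
  moreover have "1 \<le> card (M2 x)" "x \<noteq> z' \<Longrightarrow> 2 \<le> card (M2 x)" if "x \<in> N - {u}" for x
    using card2[of x] M1(2)[of x] that by auto
  ultimately obtain c3 f where c3: "proper E' (C - {i}) c3" "inj_on f (N - {u})"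
    "\<And>x. x \<in> N - {u} \<Longrightarrow> f x \<in> C - {i} - used E' c3 x"
    using Suc.hyps(1)[of "N - {u}" E' "C - {i}" M2 c2 z'] fin two unfolding E'_def by auto
  define c4 where "c4 e = (if c2 e = i then i else c3 e)" for e
  define f4 where "f4 = f(u := i)"
  have "proper E C c4"
    unfolding proper_def
  proof (intro conjI ballI impI)
    show "c4 ` E \<subseteq> C" using c3(1) i unfolding proper_def c4_def E'_def by auto
    fix e g assume eg: "e \<in> E" "g \<in> E" "e \<noteq> g \<and> e \<inter> g \<noteq> {}"
    then have "c2 e \<noteq> c2 g" using prop2 unfolding proper_def by blast
    moreover have "c3 e \<noteq> c3 g" if "c2 e \<noteq> i" "c2 g \<noteq> i"
      using that c3(1) eg unfolding proper_def E'_def by blast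
    moreover have "c3 h \<noteq> i" if "h \<in> E" "c2 h \<noteq> i" for h
      using that c3(1) unfolding proper_def E'_def by auto
    ultimately show "c4 e \<noteq> c4 g" using eg(1,2) unfolding c4_def by metis
  qed
  moreover have "inj_on f4 N"
    using c3(2,3) unfolding f4_def inj_on_def by auto
  moreover have "f4 x \<in> C - used E c4 x" if "x \<in> N" for x
  proof (cases "x = u")
    case True
    have "i \<notin> used E c2 u" using fl2 uN unfolding free_lists_def by blast
    then have "i \<notin> used E c4 u" using c3(1)
      unfolding used_def c4_def proper_def E'_def by (auto split: if_splits)
    then show ?thesis using True i unfolding f4_def by simp
  next
    case False
    then have "f x \<in> C - {i} - used E' c3 x" using c3(3) that by blast
    then show ?thesis using False unfolding f4_def used_def c4_def E'_def by auto
  qed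
  ultimately show ?case by blast
qed

text \<open>Without \<open>v\<close>, a neighbour \<open>x\<close> has lost one edge, so at least
\<open>k + 1 - deg E x\<close> colours are missing at it: at least two, except for the at most one neighbour of
degree \<open>k\<close>. Colouring the edges at \<open>v\<close> amounts to choosing distinct missing colours.\<close>

lemma extend_to_vertex:
  assumes fin: "finite E" and two: "\<And>e. e \<in> E \<Longrightarrow> card e = 2"
    and c: "proper {e \<in> E. v \<notin> e} {1..k} c"
    and degk: "\<And>x. deg E x \<le> k"
    and one: "\<And>x y. {v, x} \<in> E \<Longrightarrow> {v, y} \<in> E \<Longrightarrow> deg E x = k \<Longrightarrow> deg E y = k \<Longrightarrow> x = y"
  shows "\<exists>c. proper E {1..k} c"
proof -
  let ?F = "{e \<in> E. v \<notin> e}" and ?C = "{1..k}"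
  define N where "N = {x. {v, x} \<in> E}"
  have vN: "x \<noteq> v" if "x \<in> N" for x using that two[of "{v, x}"] unfolding N_def by auto
  have star: "{e \<in> E. v \<in> e} = (\<lambda>x. {v, x}) ` N"
  proof -
    have "\<exists>x. e = {v, x}" if "e \<in> E" "v \<in> e" for e
      using two[OF that(1)] that(2) unfolding card_2_iff by (auto simp: insert_commute)
    then show ?thesis unfolding N_def by auto
  qed
  have inj: "inj_on (\<lambda>x. {v, x}) N" by (auto simp: inj_on_def doubleton_eq_iff)
  have cardN: "card N = deg E v"
    unfolding deg_def star using inj by (simp add: card_image)
  have finN: "finite N"
  proof (rule finite_imageD[OF _ inj])
    show "finite ((\<lambda>x. {v, x}) ` N)" unfolding star[symmetric] using fin by simp
  qed
  define M where "M x = ?C - used ?F c x" for x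
  have cardM: "k + 1 \<le> card (M x) + deg E x" if "x \<in> N" for x
  proof -
    have "card {e \<in> ?F. x \<in> e} \<le> card ({e \<in> E. x \<in> e} - {{v, x}})"
      using fin by (intro card_mono) auto
    also have "\<dots> < card {e \<in> E. x \<in> e}"
      using fin that unfolding N_def by (intro card_Diff1_less) auto
    finally have "card {e \<in> ?F. x \<in> e} < card {e \<in> E. x \<in> e}" .
    moreover have "card (used ?F c x) \<le> card {e \<in> ?F. x \<in> e}"
      unfolding used_def using fin by (intro card_image_le) auto
    moreover have "card ?C - card (used ?F c x) \<le> card (M x)"
      unfolding M_def using fin by (intro diff_card_le_card_Diff) (auto simp: used_def)
    ultimately show ?thesis unfolding deg_def by simp
  qed
  have "\<exists>z. \<forall>x\<in>N. x \<noteq> z \<longrightarrow> deg E x < k"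
    using one degk unfolding N_def by (metis le_neq_implies_less mem_Collect_eq)
  then obtain z where z: "\<And>x. x \<in> N \<Longrightarrow> x \<noteq> z \<Longrightarrow> deg E x < k" by blast
  have "\<exists>c' f. proper ?F ?C c' \<and> inj_on f N \<and> (\<forall>x\<in>N. f x \<in> ?C - used ?F c' x)"
  proof (rule extend_to_star[where M = M and c = c and z = z])
    show "free_lists ?F ?C N M c" using c unfolding free_lists_def M_def by auto
    show "1 \<le> card (M x)" if "x \<in> N" for x using cardM[OF that] degk[of x] by linarith
    show "2 \<le> card (M x)" if "x \<in> N" "x \<noteq> z" for x using cardM[OF that(1)] z[OF that] by linarith
    show "card N \<le> card ?C" using cardN degk[of v] by simp
  qed (use fin finN two in auto)
  then obtain c' f where c': "proper ?F ?C c'" "inj_on f N"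
    "\<And>x. x \<in> N \<Longrightarrow> f x \<in> ?C - used ?F c' x" by blast
  define d where "d e = (if v \<in> e then f (THE x. e = {v, x}) else c' e)" for e
  have dN: "d {v, x} = f x" for x
  proof -
    have "(THE y. {v, x} = {v, y}) = x" by (rule the_equality) (auto simp: doubleton_eq_iff)
    then show ?thesis unfolding d_def by simp
  qed
  have dF: "d e = c' e" if "v \<notin> e" for e using that unfolding d_def by simp
  have cross: "d e \<noteq> d g" if "e \<in> E" "g \<in> E" "e \<inter> g \<noteq> {}" "v \<in> e" "v \<notin> g" for e g
  proof -
    have "e \<in> (\<lambda>x. {v, x}) ` N" unfolding star[symmetric] using that by simp
    then obtain x where x: "x \<in> N" "e = {v, x}" by blast
    then have "x \<in> g" using that by auto
    then have "c' g \<in> used ?F c' x" using that unfolding used_def by auto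
    then show ?thesis using c'(3)[OF x(1)] dN[of x] dF[OF that(5)] x(2) by auto
  qed
  have "proper E ?C d"
    unfolding proper_def
  proof (intro conjI ballI impI)
    show "d ` E \<subseteq> ?C"
    proof
      fix y assume "y \<in> d ` E"
      then obtain e where e: "e \<in> E" "y = d e" by auto
      show "y \<in> ?C"
      proof (cases "v \<in> e")
        case True
        then have "e \<in> (\<lambda>x. {v, x}) ` N" unfolding star[symmetric] using e by simp
        then obtain x where "x \<in> N" "e = {v, x}" by blast
        then show ?thesis using c'(3) dN e by auto
      next
        case False
        then show ?thesis using c'(1) dF e unfolding proper_def by auto
      qed
    qed
    fix e g assume eg: "e \<in> E" "g \<in> E" "e \<noteq> g \<and> e \<inter> g \<noteq> {}"
    consider "v \<in> e" "v \<in> g" | "v \<in> e" "v \<notin> g" | "v \<notin> e" "v \<in> g" | "v \<notin> e" "v \<notin> g" by blast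
    then show "d e \<noteq> d g"
    proof cases
      case 1
      have "e \<in> (\<lambda>x. {v, x}) ` N" "g \<in> (\<lambda>x. {v, x}) ` N"
        unfolding star[symmetric] using eg 1 by simp_all
      then obtain x y where x: "x \<in> N" "e = {v, x}" and y: "y \<in> N" "g = {v, y}" by blast
      have "x \<noteq> y" using x y eg by auto
      then show ?thesis using c'(2) x y dN unfolding inj_on_def by metis
    next
      case 2
      then show ?thesis using cross eg by blast
    next
      case 3
      then show ?thesis using cross[of g e] eg by (metis inf_commute)
    next
      case 4
      then show ?thesis using c'(1) dF eg unfolding proper_def by auto
    qed
  qed
  then show ?thesis by blast
qed

text \<open>Vertices are added one at a time, in an order in which each new vertex has at most one neighbour of
degree \<open>k\<close> among its predecessors: in every vertex set \<open>W\<close> the hypothesis, applied to the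
vertices of degree \<open>k\<close> in \<open>W\<close>, provides a candidate for the last vertex; if \<open>W\<close> contains no such vertices, any
vertex will do.\<close>

lemma fournier:
  assumes finV: "finite V" and E: "\<And>e. e \<in> E \<Longrightarrow> e \<subseteq> V \<and> card e = 2"
    and degk: "\<And>x. deg E x \<le> k"
    and sparse_core: "\<And>S. S \<noteq> {} \<Longrightarrow> S \<subseteq> V \<Longrightarrow> (\<And>x. x \<in> S \<Longrightarrow> deg E x = k) \<Longrightarrow>
      \<exists>x\<in>S. card {y \<in> S. {x, y} \<in> E} \<le> 1"
  shows "\<exists>c. proper E {1..k} c"
proof -
  have finE: "finite E" using E finV by (meson finite_Pow_iff finite_subset PowI subsetI)
  have "\<exists>c. proper {e \<in> E. e \<subseteq> W} {1..k} c" if "W \<subseteq> V" for W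
    using finite_subset[OF that finV] that
  proof (induction W rule: finite_psubset_induct)
    case (psubset W)
    let ?E = "{e \<in> E. e \<subseteq> W}"
    have deg_le: "deg ?E x \<le> deg E x" for x
      unfolding deg_def using finE by (intro card_mono) auto
    show ?case
    proof (cases "W = {}")
      case True
      then have "?E = {}" using E by force
      then show ?thesis unfolding proper_def by auto
    next
      case False
      let ?S = "{x \<in> W. deg E x = k}"
      have "\<exists>v\<in>W. card {y \<in> ?S. {v, y} \<in> E} \<le> 1"
      proof (cases "?S = {}")
        case True
        then show ?thesis using False by (metis (no_types, lifting) all_not_in_conv card.empty empty_Collect_eq le0 mem_Collect_eq)
      next
        case False
        then show ?thesis using sparse_core[of ?S] psubset.prems by blast
      qed
      then obtain v where v: "v \<in> W" "card {y \<in> ?S. {v, y} \<in> E} \<le> 1" by blast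
      have "{e \<in> ?E. v \<notin> e} = {e \<in> E. e \<subseteq> W - {v}}" by auto
      moreover obtain c where "proper {e \<in> E. e \<subseteq> W - {v}} {1..k} c"
        using psubset.IH[of "W - {v}"] v(1) psubset.prems by auto
      ultimately have c: "proper {e \<in> ?E. v \<notin> e} {1..k} c" by simp
      show ?thesis
      proof (rule extend_to_vertex[OF _ _ c])
        show "deg ?E x \<le> k" for x using deg_le[of x] degk[of x] by linarith
        fix x y assume xy: "{v, x} \<in> ?E" "{v, y} \<in> ?E" "deg ?E x = k" "deg ?E y = k"
        have "deg E x = k" "deg E y = k" using deg_le[of x] deg_le[of y] degk[of x] degk[of y] xy by auto
        then have "{x, y} \<subseteq> {y \<in> ?S. {v, y} \<in> E}" using xy by auto
        moreover have "finite {y \<in> ?S. {v, y} \<in> E}" using psubset.hyps by auto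
        ultimately show "x = y" using v(2) card_le_Suc0_iff_eq by auto
      qed (use finE E in auto)
    qed
  qed
  from this[of V] have "\<exists>c. proper {e \<in> E. e \<subseteq> V} {1..k} c" by simp
  moreover have "{e \<in> E. e \<subseteq> V} = E" using E by auto
  ultimately show ?thesis by simp
qed

definition core :: "'a set \<Rightarrow> 'a set set \<Rightarrow> 'a set" where
  "core V E = {x \<in> V. \<forall>y\<in>V. deg E y \<le> deg E x}"

definition nbrs :: "'a set set \<Rightarrow> 'a \<Rightarrow> 'a set" where
  "nbrs E x = {y. {x, y} \<in> E}"

lemma star_eq_nbrs:
  assumes "\<And>e. e \<in> E \<Longrightarrow> card e = 2"
  shows "{e \<in> E. x \<in> e} = (\<lambda>y. {x, y}) ` nbrs E x"
proof -
  have "\<exists>y. e = {x, y}" if "e \<in> E" "x \<in> e" for e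
    using assms[OF that(1)] that(2) unfolding card_2_iff by (auto simp: insert_commute)
  then show ?thesis unfolding nbrs_def by auto
qed

lemma card_nbrs:
  assumes "\<And>e. e \<in> E \<Longrightarrow> card e = 2"
  shows "card (nbrs E x) = deg E x"
proof -
  have "{e \<in> E. x \<in> e} = (\<lambda>y. {x, y}) ` nbrs E x" using assms by (rule star_eq_nbrs)
  then show ?thesis
    unfolding deg_def by (simp add: card_image inj_on_def doubleton_eq_iff)
qed

lemma colours_ge_deg:
  assumes fin: "finite E" and c: "proper E {1..k} c"
  shows "deg E x \<le> k"
proof -
  have "deg E x = card (c ` {e \<in> E. x \<in> e})"
    unfolding deg_def using c by (intro card_image[symmetric]) (auto simp: inj_on_def proper_def)
  also have "\<dots> \<le> card {1..k}" using c unfolding proper_def by (intro card_mono) auto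
  finally show ?thesis by simp
qed

lemma class_1_if_sparse_core:
  assumes V: "finite V" "V \<noteq> {}" and E: "\<And>e. e \<in> E \<Longrightarrow> e \<subseteq> V \<and> card e = 2"
    and sparse: "\<And>S. S \<noteq> {} \<Longrightarrow> S \<subseteq> core V E \<Longrightarrow> \<exists>x\<in>S. card {y \<in> S. {x, y} \<in> E} \<le> 1"
  shows "class_1 (V, E)"
proof -
  define k where "k = max_degree (V, E)"
  have vdeg: "vertex_degree (V, E) = deg E" by (auto simp: vertex_degree_def edges_def deg_def)
  have k: "k = Max (deg E ` V)" by (simp add: k_def max_degree_def vdeg verts_def)
  have finE: "finite E" using E V(1) by (meson finite_Pow_iff finite_subset PowI subsetI)
  have degV: "deg E x \<le> k" if "x \<in> V" for x unfolding k using V that by (intro Max_ge) auto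
  have degk: "deg E x \<le> k" for x
  proof (cases "x \<in> V")
    case False
    then have "{e \<in> E. x \<in> e} = {}" using E by auto
    then show ?thesis unfolding deg_def by (simp only: card.empty)
  qed (rule degV)
  have "k \<in> deg E ` V" unfolding k using V by (intro Max_in) auto
  then obtain m where m: "m \<in> V" "deg E m = k" by auto
  have "\<exists>c. proper E {1..k} c"
  proof (rule fournier[OF V(1) E degk])
    fix S assume S: "S \<noteq> {}" "S \<subseteq> V" "\<And>x. x \<in> S \<Longrightarrow> deg E x = k"
    then have "S \<subseteq> core V E" using degV unfolding core_def by auto
    then show "\<exists>x\<in>S. card {y \<in> S. {x, y} \<in> E} \<le> 1" using sparse S(1) by blast
  qed
  moreover have "k \<le> k'" if "\<exists>c. proper E {1..k'} c" for k'
    using that colours_ge_deg[OF finE, of k' _ m] m by auto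
  ultimately have least: "(LEAST k'. \<exists>c. proper E {1..k'} c) = k" by (intro Least_equality)
  have proper_iff: "proper_edge_colouring (V, E) k' c = proper E {1..k'} c" for k' c
    unfolding proper_edge_colouring_def proper_def edges_def by simp
  show ?thesis
    unfolding class_1_def chromatic_index_def proper_iff least by (rule k_def)
qed

section \<open>Random subsets of a finite set\<close>

definition random_subset :: "'a set \<Rightarrow> real \<Rightarrow> 'a set pmf" where
  "random_subset K p = map_pmf (\<lambda>\<omega>. {e \<in> K. \<omega> e}) (Pi_pmf K False (\<lambda>_. bernoulli_pmf p))"

lemma set_random_subset: "set_pmf (random_subset K p) \<subseteq> Pow K"
  unfolding random_subset_def by auto

lemma pmf_random_subset:
  fixes p :: real
  assumes "finite K" "p \<in> {0..1}" "E \<subseteq> K"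
  shows "pmf (random_subset K p) E = p ^ card E * (1 - p) ^ card (K - E)"
proof -
  have "(\<lambda>\<omega>. {e \<in> K. \<omega> e}) -` {E} = Pi K (\<lambda>e. {e \<in> E})" using assms by auto
  then have "pmf (random_subset K p) E = (\<Prod>e\<in>K. measure_pmf.prob (bernoulli_pmf p) {e \<in> E})"
    unfolding random_subset_def pmf_map using assms by (simp add: measure_Pi_pmf_Pi)
  also have "\<dots> = (\<Prod>e\<in>K. if e \<in> E then p else 1 - p)"
    using assms by (intro prod.cong) (auto simp: measure_pmf_single)
  also have "\<dots> = p ^ card E * (1 - p) ^ card (K - E)"
    using assms by (simp add: prod.If_cases Int_absorb1 Diff_eq)
  finally show ?thesis .
qed

lemma prob_superset:
  fixes p :: real
  assumes "finite K" "p \<in> {0..1}" "F \<subseteq> K"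
  shows "measure_pmf.prob (random_subset K p) {E. F \<subseteq> E} = p ^ card F"
proof -
  have "(\<lambda>\<omega>. {e \<in> K. \<omega> e}) -` {E. F \<subseteq> E} = Pi K (\<lambda>e. if e \<in> F then {True} else UNIV)"
    using assms(3) by (fastforce split: if_splits)
  then have "measure_pmf.prob (random_subset K p) {E. F \<subseteq> E}
      = (\<Prod>e\<in>K. measure_pmf.prob (bernoulli_pmf p) (if e \<in> F then {True} else UNIV))"
    unfolding random_subset_def using assms by (simp add: measure_Pi_pmf_Pi)
  also have "\<dots> = (\<Prod>e\<in>K. if e \<in> F then p else 1)"
    using assms by (intro prod.cong) (auto simp: measure_pmf_single)
  also have "\<dots> = p ^ card F"
    using assms by (simp add: prod.If_cases Int_absorb1)
  finally show ?thesis .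
qed

lemma union_bound_supersets:
  fixes p :: real
  assumes K: "finite K" "p \<in> {0..1}" and F: "finite \<F>" "\<And>F. F \<in> \<F> \<Longrightarrow> F \<subseteq> K \<and> card F = s"
  shows "measure_pmf.prob (random_subset K p) {E. \<exists>F\<in>\<F>. F \<subseteq> E} \<le> card \<F> * p ^ s"
proof -
  have "{E. \<exists>F\<in>\<F>. F \<subseteq> E} = (\<Union>F\<in>\<F>. {E. F \<subseteq> E})" by auto
  then have "measure_pmf.prob (random_subset K p) {E. \<exists>F\<in>\<F>. F \<subseteq> E}
      \<le> (\<Sum>F\<in>\<F>. measure_pmf.prob (random_subset K p) {E. F \<subseteq> E})"
    using measure_UNION_le[of \<F> "\<lambda>F. {E. F \<subseteq> E}" "measure_pmf (random_subset K p)"] F(1) by simp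
  also have "\<dots> = (\<Sum>F\<in>\<F>. p ^ s)"
    using prob_superset[OF K] F(2) by (intro sum.cong) auto
  finally show ?thesis by simp
qed

lemma prob_finite_support:
  assumes "finite S" "set_pmf R \<subseteq> S"
  shows "measure_pmf.prob R A = (\<Sum>E\<in>S. pmf R E * (if E \<in> A then 1 else 0))"
proof -
  have "measure_pmf.prob R A = measure_pmf.prob R (A \<inter> S)"
    using assms(2) by (intro measure_prob_cong_0) (auto simp: set_pmf_iff)
  also have "\<dots> = (\<Sum>E\<in>A \<inter> S. pmf R E)"
    using assms(1) by (intro measure_measure_pmf_finite) auto
  also have "\<dots> = (\<Sum>E\<in>S. pmf R E * (if E \<in> A then 1 else 0))"
    using assms(1) by (intro sum.mono_neutral_cong_left) auto
  finally show ?thesis .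
qed

lemma sum_prob_eq_expected_count:
  assumes "finite S" "set_pmf R \<subseteq> S" "finite T"
  shows "(\<Sum>t\<in>T. measure_pmf.prob R (A t)) = (\<Sum>E\<in>S. pmf R E * card {t \<in> T. E \<in> A t})"
proof -
  have "(\<Sum>t\<in>T. measure_pmf.prob R (A t)) = (\<Sum>t\<in>T. \<Sum>E\<in>S. pmf R E * (if E \<in> A t then 1 else 0))"
    using prob_finite_support[OF assms(1,2)] by simp
  also have "\<dots> = (\<Sum>E\<in>S. \<Sum>t\<in>T. pmf R E * (if E \<in> A t then 1 else 0))"
    by (rule sum.swap)
  also have "\<dots> = (\<Sum>E\<in>S. pmf R E * card {t \<in> T. E \<in> A t})"
    using assms(3) by (simp add: sum_distrib_left[symmetric] sum.If_cases Int_def)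
  finally show ?thesis .
qed

text \<open>Replacing \<open>A\<close> by \<open>B\<close> is injective on \<open>X\<close>. For each element gained, the
probability of an outcome receives a factor \<open>p\<close> and loses a factor \<open>1 - p\<close>, which is
at most one.\<close>

lemma switching:
  fixes p :: real
  assumes K: "finite K" and p: "p \<in> {0..1}" and AB: "A \<subseteq> K" "B \<subseteq> K" "card A \<le> card B"
    and X: "\<And>E. E \<in> X \<Longrightarrow> E \<subseteq> K \<and> A \<subseteq> E \<and> B \<inter> E = {}"
    and XY: "\<And>E. E \<in> X \<Longrightarrow> E - A \<union> B \<in> Y"
  shows "p ^ card B * measure_pmf.prob (random_subset K p) X
    \<le> p ^ card A * measure_pmf.prob (random_subset K p) Y"
proof -
  let ?R = "random_subset K p" and ?f = "\<lambda>E. E - A \<union> B"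
  have finX: "finite X" using X K by (meson Pow_iff finite_Pow_iff finite_subset subsetI)
  have inj: "inj_on ?f X"
  proof (rule inj_onI)
    fix E E' assume "E \<in> X" "E' \<in> X" "?f E = ?f E'"
    moreover have "E = (?f E - B) \<union> A" if "E \<in> X" for E using X[OF that] by blast
    ultimately show "E = E'" by metis
  qed
  have "p ^ card B * pmf ?R E \<le> p ^ card A * pmf ?R (?f E)" if "E \<in> X" for E
  proof -
    note XE = X[OF that]
    have fin: "finite E" "finite A" "finite B" using XE K AB finite_subset by auto
    have c1: "card (E - A) + card A = card E"
      using XE fin by (metis card_Diff_subset card_mono le_add_diff_inverse2)
    have c2: "card (?f E) = card (E - A) + card B"
      using XE fin by (intro card_Un_disjoint) auto
    have "card K = card (?f E) + card (K - ?f E)" "card K = card E + card (K - E)"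
      using K XE AB by (metis (no_types, lifting) Diff_subset Un_least card_Diff_subset card_mono
        finite_subset le_add_diff_inverse order_trans)+
    then have c3: "card (K - ?f E) + (card B - card A) = card (K - E)"
      using c1 c2 AB(3) by linarith
    have "p ^ card B * pmf ?R E = p ^ (card B + card E) * (1 - p) ^ card (K - E)"
      using pmf_random_subset[OF K p] XE by (simp add: power_add)
    also have "\<dots> \<le> p ^ (card B + card E) * (1 - p) ^ card (K - ?f E)"
      using p c3 by (intro mult_left_mono power_decreasing) auto
    also have "card B + card E = card A + card (?f E)" using c1 c2 by simp
    also have "p ^ (card A + card (?f E)) * (1 - p) ^ card (K - ?f E) = p ^ card A * pmf ?R (?f E)"
    proof -
      have "?f E \<subseteq> K" using XE AB by blast
      then show ?thesis using pmf_random_subset[OF K p, of "?f E"] by (simp only: power_add mult.assoc)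
    qed
    finally show ?thesis .
  qed
  then have "(\<Sum>E\<in>X. p ^ card B * pmf ?R E) \<le> (\<Sum>E\<in>X. p ^ card A * pmf ?R (?f E))"
    by (rule sum_mono)
  also have "\<dots> = p ^ card A * (\<Sum>E\<in>?f ` X. pmf ?R E)"
    using inj by (simp add: sum.reindex sum_distrib_left)
  also have "(\<Sum>E\<in>?f ` X. pmf ?R E) = measure_pmf.prob ?R (?f ` X)"
    using finX by (simp add: measure_measure_pmf_finite)
  also have "p ^ card A * \<dots> \<le> p ^ card A * measure_pmf.prob ?R Y"
    using p XY by (intro mult_left_mono measure_pmf.finite_measure_mono) auto
  finally show ?thesis
    using finX by (simp add: measure_measure_pmf_finite sum_distrib_left)
qed

section \<open>The switching bound for adjacent vertices of maximum degree\<close>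

lemma card_Sigma_ge:
  assumes "finite A" "\<And>x. x \<in> A \<Longrightarrow> finite (B x)" "a \<le> card A" "\<And>x. x \<in> A \<Longrightarrow> b \<le> card (B x)"
  shows "a * b \<le> card (Sigma A B)"
proof -
  have "a * b \<le> card A * b" using assms(3) by simp
  also have "\<dots> \<le> (\<Sum>x\<in>A. card (B x))" using sum_bounded_below[of A b "\<lambda>x. card (B x)"] assms(4) by simp
  also have "\<dots> = card (Sigma A B)" using assms(1,2) by simp
  finally show ?thesis .
qed

lemma card_Sigma_le:
  assumes "finite A" "\<And>x. x \<in> A \<Longrightarrow> finite (B x)" "card A \<le> a" "\<And>x. x \<in> A \<Longrightarrow> card (B x) \<le> b"
  shows "card (Sigma A B) \<le> a * b"
proof -
  have "card (Sigma A B) = (\<Sum>x\<in>A. card (B x))" using assms(1,2) by simp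
  also have "\<dots> \<le> card A * b" using sum_bounded_above[of A "\<lambda>x. card (B x)" b] assms(4) by simp
  also have "\<dots> \<le> a * b" using assms(3) by simp
  finally show ?thesis .
qed

lemma switch_degrees:
  assumes E: "finite E"
    and uv: "{u, v} \<in> E" and new: "{u, x1} \<notin> E" "{u, x2} \<notin> E" "{v, y1} \<notin> E" "{v, y2} \<notin> E"
    and dist: "distinct [u, v, x1, x2, y1, y2]"
  defines "E' \<equiv> E - {{u, v}} \<union> {{u, x1}, {u, x2}, {v, y1}, {v, y2}}"
  shows "deg E' u = deg E u + 1" "deg E' v = deg E v + 1"
    "z \<notin> {u, v} \<Longrightarrow> deg E' z \<le> deg E z + 1"
    "z \<notin> {u, v, x1, x2, y1, y2} \<Longrightarrow> deg E' z = deg E z"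
proof -
  have two_new: "card (S - {e} \<union> {a, b}) = card S + 1"
    if "finite S" "e \<in> S" "a \<notin> S" "b \<notin> S" "a \<noteq> b" for S :: "'a set set" and e a b
  proof -
    have "card (S - {e} \<union> {a, b}) = card (S - {e}) + card {a, b}"
      using that by (intro card_Un_disjoint) auto
    then show ?thesis using that card_Suc_Diff1[OF that(1,2)] by simp
  qed
  define B where "B = {{u, x1}, {u, x2}, {v, y1}, {v, y2}}"
  have at: "{e \<in> E'. z \<in> e} = {e \<in> E. z \<in> e} - {{u, v}} \<union> {e \<in> B. z \<in> e}" for z
    unfolding E'_def B_def[symmetric] by blast
  have "{e \<in> B. u \<in> e} = {{u, x1}, {u, x2}}" "{e \<in> B. v \<in> e} = {{v, y1}, {v, y2}}"
    using dist unfolding B_def by auto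
  note at_uv = at[of u, unfolded this] at[of v, unfolded this]
  have "{e \<in> E'. u \<in> e} = {e \<in> E. u \<in> e} - {{u, v}} \<union> {{u, x1}, {u, x2}}"
    by (rule at_uv)
  moreover have "card ({e \<in> E. u \<in> e} - {{u, v}} \<union> {{u, x1}, {u, x2}}) = card {e \<in> E. u \<in> e} + 1"
    using E uv new dist by (intro two_new) (simp_all add: doubleton_eq_iff)
  ultimately show "deg E' u = deg E u + 1" unfolding deg_def by simp
  have "{e \<in> E'. v \<in> e} = {e \<in> E. v \<in> e} - {{u, v}} \<union> {{v, y1}, {v, y2}}"
    by (rule at_uv)
  moreover have "card ({e \<in> E. v \<in> e} - {{u, v}} \<union> {{v, y1}, {v, y2}}) = card {e \<in> E. v \<in> e} + 1"
    using E uv new dist by (intro two_new) (simp_all add: doubleton_eq_iff)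
  ultimately show "deg E' v = deg E v + 1" unfolding deg_def by simp
  show "deg E' z \<le> deg E z + 1" if z: "z \<notin> {u, v}"
  proof -
    have "\<exists>e. {e \<in> B. z \<in> e} \<subseteq> {e}"
    proof (cases "z \<in> {x1, x2}")
      case True
      then have "z \<notin> {v, y1, y2}" using z dist by auto
      then have "e = {u, z}" if "e \<in> B" "z \<in> e" for e using that z unfolding B_def by auto
      then show ?thesis by blast
    next
      case False
      then have "e = {v, z}" if "e \<in> B" "z \<in> e" for e using that z unfolding B_def by auto
      then show ?thesis by blast
    qed
    then obtain e where "{e \<in> B. z \<in> e} \<subseteq> {e}" by blast
    then have e: "{e \<in> E'. z \<in> e} \<subseteq> insert e {e \<in> E. z \<in> e}" unfolding at by blast
    have "deg E' z \<le> card (insert e {e \<in> E. z \<in> e})"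
      unfolding deg_def using E e by (intro card_mono) auto
    also have "\<dots> \<le> deg E z + 1" unfolding deg_def by (simp add: card_insert_le_m1 card_insert_if)
    finally show ?thesis .
  qed
  show "deg E' z = deg E z" if "z \<notin> {u, v, x1, x2, y1, y2}"
  proof -
    have "{e \<in> B. z \<in> e} = {}" using that unfolding B_def by auto
    moreover have "{e \<in> E. z \<in> e} - {{u, v}} = {e \<in> E. z \<in> e}" using that by auto
    ultimately have "{e \<in> E'. z \<in> e} = {e \<in> E. z \<in> e}"
      unfolding at by (simp only: Un_empty_right)
    then show ?thesis unfolding deg_def by simp
  qed
qed

definition all_edges :: "'a set \<Rightarrow> 'a set set" where
  "all_edges V = {e. e \<subseteq> V \<and> card e = 2}"

definition adjacent_core :: "'a set \<Rightarrow> 'a set set \<Rightarrow> bool" where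
  "adjacent_core V E \<longleftrightarrow> (\<exists>u\<in>core V E. \<exists>v\<in>core V E. {u, v} \<in> E)"

lemma finite_all_edges: "finite V \<Longrightarrow> finite (all_edges V)"
  unfolding all_edges_def by (rule finite_subset[of _ "Pow V"]) auto

lemma nbrs_subset: "E \<subseteq> all_edges V \<Longrightarrow> nbrs E x \<subseteq> V - {x}"
  unfolding nbrs_def all_edges_def by fastforce

lemma card_nbrs_all_edges: "E \<subseteq> all_edges V \<Longrightarrow> card (nbrs E x) = deg E x"
  by (rule card_nbrs) (auto simp: all_edges_def)

text \<open>In a tuple \<open>(u, v, x1, x2, y1, y2)\<close> the edge between \<open>u\<close> and \<open>v\<close> is to be
replaced by edges from \<open>u\<close> to \<open>x1\<close> and \<open>x2\<close> and from \<open>v\<close> to \<open>y1\<close>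
and \<open>y2\<close>. Raising both degrees above the old maximum is what makes the switch traceable: the
new vertices of maximum degree are among the six vertices of the tuple.\<close>

definition switch_tuples :: "'a set \<Rightarrow> ('a \<times> 'a \<times> 'a \<times> 'a \<times> 'a \<times> 'a) set" where
  "switch_tuples V = {(u, v, x1, x2, y1, y2).
     {u, v, x1, x2, y1, y2} \<subseteq> V \<and> distinct [u, v, x1, x2, y1, y2]}"

fun switchable :: "'a set \<Rightarrow> nat \<Rightarrow> 'a \<times> 'a \<times> 'a \<times> 'a \<times> 'a \<times> 'a \<Rightarrow> 'a set set set" where
  "switchable V D (u, v, x1, x2, y1, y2) = {E. E \<subseteq> all_edges V \<and> {u, v} \<subseteq> core V E \<and>
     (\<forall>x\<in>V. deg E x \<le> D) \<and>
     {u, v} \<in> E \<and> {u, x1} \<notin> E \<and> {u, x2} \<notin> E \<and> {v, y1} \<notin> E \<and> {v, y2} \<notin> E}"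

fun switched :: "'a set \<Rightarrow> nat \<Rightarrow> 'a \<times> 'a \<times> 'a \<times> 'a \<times> 'a \<times> 'a \<Rightarrow> 'a set set set" where
  "switched V D (u, v, x1, x2, y1, y2) = {E. E \<subseteq> all_edges V \<and> {u, v} \<subseteq> core V E \<and>
     (\<forall>x\<in>V. deg E x \<le> D + 1) \<and> card (core V E) \<le> 6 \<and>
     {u, x1} \<in> E \<and> {u, x2} \<in> E \<and> {v, y1} \<in> E \<and> {v, y2} \<in> E}"

lemma finite_switch_tuples: "finite V \<Longrightarrow> finite (switch_tuples V)"
  by (rule finite_subset[of _ "V \<times> V \<times> V \<times> V \<times> V \<times> V"]) (auto simp: switch_tuples_def)

lemma switch_maps_to_switched:
  assumes V: "finite V" and t: "(u, v, x1, x2, y1, y2) \<in> switch_tuples V"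
    and E: "E \<in> switchable V D (u, v, x1, x2, y1, y2)"
  shows "E - {{u, v}} \<union> {{u, x1}, {u, x2}, {v, y1}, {v, y2}} \<in> switched V D (u, v, x1, x2, y1, y2)"
proof -
  define E' where "E' = E - {{u, v}} \<union> {{u, x1}, {u, x2}, {v, y1}, {v, y2}}"
  have dist: "distinct [u, v, x1, x2, y1, y2]" and inV: "{u, v, x1, x2, y1, y2} \<subseteq> V"
    using t unfolding switch_tuples_def by auto
  have EK: "E \<subseteq> all_edges V" and coreE: "u \<in> core V E" "v \<in> core V E"
    and degD: "\<And>x. x \<in> V \<Longrightarrow> deg E x \<le> D"
    and uv: "{u, v} \<in> E" and new: "{u, x1} \<notin> E" "{u, x2} \<notin> E" "{v, y1} \<notin> E" "{v, y2} \<notin> E"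
    using E by auto
  have finE: "finite E" using EK finite_all_edges[OF V] by (rule finite_subset)
  note sd = switch_degrees[OF finE uv new dist, folded E'_def]
  have du: "deg E x \<le> deg E u" "deg E x \<le> deg E v" if "x \<in> V" for x
    using coreE that unfolding core_def by auto
  have duv: "deg E u = deg E v" using du[of u] du[of v] inV by auto
  have max: "deg E' x \<le> deg E u + 1" if "x \<in> V" for x
    using sd(1,2) sd(3)[of x] du[OF that] duv by (cases "x \<in> {u, v}") auto
  have "core V E' \<subseteq> {u, v, x1, x2, y1, y2}"
  proof
    fix x assume x: "x \<in> core V E'"
    show "x \<in> {u, v, x1, x2, y1, y2}"
    proof (rule ccontr)
      assume "x \<notin> {u, v, x1, x2, y1, y2}"
      then have "deg E' x = deg E x" by (rule sd(4))
      moreover have "deg E' u \<le> deg E' x" "x \<in> V" using x inV unfolding core_def by auto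
      ultimately show False using sd(1) du(1)[of x] by simp
    qed
  qed
  then have "card (core V E') \<le> card {u, v, x1, x2, y1, y2}" by (intro card_mono) auto
  also have "\<dots> = 6" using dist by simp
  finally have "card (core V E') \<le> 6" .
  moreover have "{u, v} \<subseteq> core V E'"
    using max sd(1,2) duv inV unfolding core_def by auto
  moreover have "E' \<subseteq> all_edges V"
    using EK inV dist unfolding E'_def all_edges_def by auto
  moreover have "deg E' x \<le> D + 1" if "x \<in> V" for x
    using max[OF that] degD[of u] inV by auto
  ultimately have "E' \<in> switched V D (u, v, x1, x2, y1, y2)"
    unfolding E'_def by simp
  then show ?thesis unfolding E'_def .
qed

text \<open>Each of the four new endpoints has to avoid at most \<open>D\<close> neighbours and at most four other
vertices. The neighbours of \<open>u\<close> include \<open>v\<close>, and conversely.\<close>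

lemma many_switchable_tuples:
  assumes V: "finite V" and E: "E \<subseteq> all_edges V" and adj: "adjacent_core V E"
    and degD: "\<And>x. x \<in> V \<Longrightarrow> deg E x \<le> D"
  shows "(card V - D - 4) ^ 4 \<le> card {t \<in> switch_tuples V. E \<in> switchable V D t}"
proof -
  obtain u v where u: "u \<in> core V E" and v: "v \<in> core V E" and uv: "{u, v} \<in> E"
    using adj unfolding adjacent_core_def by blast
  have uV: "u \<in> V" and vV: "v \<in> V" using u v unfolding core_def by auto
  have ne: "u \<noteq> v" using uv E unfolding all_edges_def by auto
  define X where "X z = V - {z} - nbrs E z" for z
  define m where "m = card V - D - 4"
  have cardX: "card V - D - 1 \<le> card (X z)" if "z \<in> V" for z
  proof -
    have "card (nbrs E z) \<le> D" using card_nbrs_all_edges[OF E] degD[OF that] by simp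
    moreover have "card (V - {z}) - card (nbrs E z) \<le> card (X z)"
      unfolding X_def using nbrs_subset[OF E] V by (intro diff_card_le_card_Diff) (auto intro: finite_subset)
    ultimately show ?thesis using that V by simp
  qed
  have finX: "finite (X z)" for z using V unfolding X_def by auto
  have cardXF: "m \<le> card (X z - F)" if "z \<in> V" "finite F" "card F \<le> 3" for z F
  proof -
    have "card (X z) - card F \<le> card (X z - F)" using that by (intro diff_card_le_card_Diff)
    then show ?thesis using cardX[OF that(1)] that(3) unfolding m_def by linarith
  qed
  define S where "S = (SIGMA x1:X u. SIGMA x2:X u - {x1}. SIGMA y1:X v - {x1, x2}. X v - {x1, x2, y1})"
  have card3: "card {a} \<le> 3" "card {a, b} \<le> 3" "card {a, b, c} \<le> 3" for a b c :: 'a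
    by (auto simp: card_insert_if)
  have mX: "m \<le> card (X u)" using cardXF[OF uV, of "{}"] by simp
  have "m * (m * (m * m)) \<le> card S"
    unfolding S_def
    by (intro card_Sigma_ge finite_SigmaI finite_Diff finX mX cardXF[OF uV] cardXF[OF vV]
        card3 finite.intros)
  also have "card S = card (Pair u ` Pair v ` S)"
    by (simp add: card_image inj_on_def)
  also have "\<dots> \<le> card {t \<in> switch_tuples V. E \<in> switchable V D t}"
  proof (rule card_mono)
    show "finite {t \<in> switch_tuples V. E \<in> switchable V D t}" using finite_switch_tuples[OF V] by simp
    have "(u, v, x1, x2, y1, y2) \<in> switch_tuples V \<and> E \<in> switchable V D (u, v, x1, x2, y1, y2)"
      if "(x1, x2, y1, y2) \<in> S" for x1 x2 y1 y2
    proof -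
      have x: "x1 \<in> X u" "x2 \<in> X u" "y1 \<in> X v" "y2 \<in> X v"
        and dist: "distinct [x1, x2, y1, y2]" using that unfolding S_def by auto
      have "v \<in> nbrs E u" "u \<in> nbrs E v" using uv unfolding nbrs_def by (auto simp: insert_commute)
      then have "distinct [u, v, x1, x2, y1, y2]" using x dist ne unfolding X_def by auto
      moreover have "{u, v, x1, x2, y1, y2} \<subseteq> V" using x uV vV unfolding X_def by auto
      moreover have "{u, x1} \<notin> E" "{u, x2} \<notin> E" "{v, y1} \<notin> E" "{v, y2} \<notin> E"
        using x unfolding X_def nbrs_def by auto
      ultimately show ?thesis using E u v uv degD unfolding switch_tuples_def by simp
    qed
    then show "Pair u ` Pair v ` S \<subseteq> {t \<in> switch_tuples V. E \<in> switchable V D t}" by fast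
  qed
  finally show ?thesis unfolding m_def by (simp only: power4_eq_xxxx mult.assoc)
qed

text \<open>The vertices \<open>u\<close> and \<open>v\<close> are found among six, the other four among the neighbours of
these.\<close>

lemma few_switched_tuples:
  assumes V: "finite V" and E: "E \<subseteq> all_edges V"
  shows "card {t \<in> switch_tuples V. E \<in> switched V D t} \<le> 36 * (D + 1) ^ 4"
proof (cases "(\<forall>x\<in>V. deg E x \<le> D + 1) \<and> card (core V E) \<le> 6")
  case False
  then have "{t \<in> switch_tuples V. E \<in> switched V D t} = {}" by auto
  then show ?thesis by (simp only: card.empty)
next
  case True
  let ?S = "SIGMA u:core V E. SIGMA v:core V E. nbrs E u \<times> nbrs E u \<times> nbrs E v \<times> nbrs E v"
  have coreV: "core V E \<subseteq> V" unfolding core_def by auto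
  have fin: "finite (core V E)" "finite (nbrs E x)" for x
    using coreV nbrs_subset[OF E, of x] V by (auto intro: finite_subset)
  have "card (nbrs E x) \<le> D + 1" if "x \<in> core V E" for x
    using True coreV that card_nbrs_all_edges[OF E] by auto
  then have card_S: "card ?S \<le> 6 * (6 * ((D + 1) * ((D + 1) * ((D + 1) * (D + 1)))))"
    using True fin by (intro card_Sigma_le finite_SigmaI) auto
  have "card {t \<in> switch_tuples V. E \<in> switched V D t} \<le> card ?S"
    using fin by (intro card_mono finite_SigmaI) (auto simp: nbrs_def)
  also note card_S
  also have "6 * (6 * (q * (q * (q * q)))) = 36 * q ^ 4" for q :: nat
    by (simp add: power4_eq_xxxx)
  finally show ?thesis .
qed

text \<open>Double counting of pairs of an edge set and a tuple, before and after the switch. Three edges are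
gained, hence the factor \<open>p ^ 3\<close>.\<close>

lemma prob_adjacent_core:
  fixes p :: real
  assumes V: "finite V" and p: "0 < p" "p \<le> 1"
  shows "p ^ 3 * real (card V - D - 4) ^ 4 *
      measure_pmf.prob (random_subset (all_edges V) p)
        {E. E \<subseteq> all_edges V \<and> adjacent_core V E \<and> (\<forall>x\<in>V. deg E x \<le> D)}
    \<le> 36 * (real D + 1) ^ 4"
proof -
  let ?K = "all_edges V" and ?T = "switch_tuples V"
  let ?R = "random_subset ?K p"
  let ?bad = "{E. E \<subseteq> ?K \<and> adjacent_core V E \<and> (\<forall>x\<in>V. deg E x \<le> D)}"
  have finK: "finite ?K" by (rule finite_all_edges[OF V])
  have sup: "finite (Pow ?K)" "set_pmf ?R \<subseteq> Pow ?K"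
    using finK set_random_subset by auto
  have finT: "finite ?T" by (rule finite_switch_tuples[OF V])
  have "real ((card V - D - 4) ^ 4) * measure_pmf.prob ?R ?bad
      = (\<Sum>E\<in>Pow ?K. pmf ?R E * (if E \<in> ?bad then real ((card V - D - 4) ^ 4) else 0))"
    unfolding prob_finite_support[OF sup, of ?bad] sum_distrib_left by (intro sum.cong) auto
  also have "\<dots> \<le> (\<Sum>E\<in>Pow ?K. pmf ?R E * card {t \<in> ?T. E \<in> switchable V D t})"
  proof (intro sum_mono mult_left_mono)
    fix E assume "E \<in> Pow ?K"
    then have "E \<in> ?bad \<Longrightarrow> (card V - D - 4) ^ 4 \<le> card {t \<in> ?T. E \<in> switchable V D t}"
      by (intro many_switchable_tuples[OF V]) auto
    then show "(if E \<in> ?bad then real ((card V - D - 4) ^ 4) else 0)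
        \<le> real (card {t \<in> ?T. E \<in> switchable V D t})" by (simp del: of_nat_power)
  qed simp
  also have "\<dots> = (\<Sum>t\<in>?T. measure_pmf.prob ?R (switchable V D t))"
    by (rule sum_prob_eq_expected_count[OF sup finT, symmetric])
  finally have lower: "real ((card V - D - 4) ^ 4) * measure_pmf.prob ?R ?bad
      \<le> (\<Sum>t\<in>?T. measure_pmf.prob ?R (switchable V D t))" .
  have step: "p ^ 4 * measure_pmf.prob ?R (switchable V D t) \<le> p * measure_pmf.prob ?R (switched V D t)"
    if t: "t \<in> ?T" for t
  proof -
    obtain u v x1 x2 y1 y2 where t_eq: "t = (u, v, x1, x2, y1, y2)" by (cases t)
    have dist: "distinct [u, v, x1, x2, y1, y2]" and inV: "{u, v, x1, x2, y1, y2} \<subseteq> V"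
      using t unfolding switch_tuples_def t_eq by auto
    let ?A = "{{u, v}}" and ?B = "{{u, x1}, {u, x2}, {v, y1}, {v, y2}}"
    have cB: "card ?B = 4" using dist by (auto simp: card_insert_if doubleton_eq_iff)
    have "p ^ card ?B * measure_pmf.prob ?R (switchable V D t)
        \<le> p ^ card ?A * measure_pmf.prob ?R (switched V D t)"
    proof (rule switching[OF finK])
      show "?A \<subseteq> ?K" "?B \<subseteq> ?K" using dist inV by (auto simp: all_edges_def)
      show "card ?A \<le> card ?B" unfolding cB by simp
      show "E \<subseteq> ?K \<and> ?A \<subseteq> E \<and> ?B \<inter> E = {}" if "E \<in> switchable V D t" for E
        using that unfolding t_eq by auto
      show "E - ?A \<union> ?B \<in> switched V D t" if "E \<in> switchable V D t" for E
        using switch_maps_to_switched[OF V] t that unfolding t_eq by blast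
    qed (use p in auto)
    then show ?thesis unfolding cB by simp
  qed
  have "(\<Sum>t\<in>?T. measure_pmf.prob ?R (switched V D t))
      = (\<Sum>E\<in>Pow ?K. pmf ?R E * card {t \<in> ?T. E \<in> switched V D t})"
    by (rule sum_prob_eq_expected_count[OF sup finT])
  also have "\<dots> \<le> (\<Sum>E\<in>Pow ?K. pmf ?R E * real (36 * (D + 1) ^ 4))"
    using few_switched_tuples[OF V] by (intro sum_mono mult_left_mono of_nat_mono) auto
  also have "\<dots> = real (36 * (D + 1) ^ 4)"
    using sum_pmf_eq_1[OF sup] by (simp add: sum_distrib_right[symmetric])
  also have "\<dots> = 36 * (real D + 1) ^ 4" by (simp add: add.commute)
  finally have upper: "(\<Sum>t\<in>?T. measure_pmf.prob ?R (switched V D t)) \<le> 36 * (real D + 1) ^ 4" .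
  have "p * (p ^ 3 * real m ^ 4 * q) = p ^ 4 * (real (m ^ 4) * q)" for m q
    by (simp add: power4_eq_xxxx power3_eq_cube)
  then have "p * (p ^ 3 * real (card V - D - 4) ^ 4 * measure_pmf.prob ?R ?bad)
      = p ^ 4 * (real ((card V - D - 4) ^ 4) * measure_pmf.prob ?R ?bad)" .
  also have "\<dots> \<le> p ^ 4 * (\<Sum>t\<in>?T. measure_pmf.prob ?R (switchable V D t))"
    using p lower by (intro mult_left_mono) auto
  also have "\<dots> \<le> p * (\<Sum>t\<in>?T. measure_pmf.prob ?R (switched V D t))"
    unfolding sum_distrib_left using step by (rule sum_mono)
  also have "\<dots> \<le> p * (36 * (real D + 1) ^ 4)"
    using p upper by (intro mult_left_mono) auto
  finally have "p * (p ^ 3 * real (card V - D - 4) ^ 4 * measure_pmf.prob ?R ?bad)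
      \<le> p * (36 * (real D + 1) ^ 4)" .
  then show ?thesis using p by simp
qed

section \<open>First moment bounds\<close>

lemma power_le_exp_fact:
  fixes x :: real
  assumes "0 \<le> x"
  shows "x ^ k \<le> exp x * fact k"
proof -
  have exp: "(\<lambda>k. x ^ k /\<^sub>R fact k) sums exp x" by (rule exp_converges)
  have "(\<Sum>i\<in>{k}. x ^ i /\<^sub>R fact i) \<le> (\<Sum>i. x ^ i /\<^sub>R fact i)"
    using assms sums_summable[OF exp] by (intro sum_le_suminf) auto
  then have "x ^ k /\<^sub>R fact k \<le> exp x" using sums_unique[OF exp] by simp
  then show ?thesis by (simp add: field_simps)
qed

lemma exp_of_nat_le: "exp (real k) \<le> 3 ^ k"
proof -
  have "exp (real k) = exp 1 ^ k" by (simp add: exp_of_nat_mult[symmetric])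
  also have "\<dots> \<le> 3 ^ k" by (intro power_mono exp_le) auto
  finally show ?thesis .
qed

lemma self_power_le_fact: "real k ^ k \<le> 3 ^ k * fact k"
proof -
  have "real k ^ k \<le> exp (real k) * fact k" by (rule power_le_exp_fact) simp
  also have "\<dots> \<le> 3 ^ k * fact k" using exp_of_nat_le by (intro mult_right_mono) auto
  finally show ?thesis .
qed

lemma choose_mult_fact_le: "real (n choose k) * fact k \<le> real n ^ k"
proof -
  have "(n choose k) * fact k \<le> n ^ k" by (rule binomial_fact_pow)
  then have "real ((n choose k) * fact k) \<le> real (n ^ k)" by (rule of_nat_mono)
  then show ?thesis by simp
qed

text \<open>Union bound over stars with \<open>d\<close> edges, whose expected number is at most \<open>card V\<close> times
\<open>(3 * card V * p / d) ^ d\<close>.\<close>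

lemma prob_max_degree_ge:
  fixes p :: real
  assumes V: "finite V" and p: "p \<in> {0..1}" and d: "9 * (real (card V) * p) \<le> real d"
  shows "measure_pmf.prob (random_subset (all_edges V) p)
      {E. E \<subseteq> all_edges V \<and> (\<exists>x\<in>V. d \<le> deg E x)} \<le> card V * exp (- real d)"
proof -
  let ?K = "all_edges V"
  let ?R = "random_subset ?K p"
  define n where "n = card V"
  define \<F> where "\<F> = (\<Union>x\<in>V. {F. F \<subseteq> {e \<in> ?K. x \<in> e} \<and> card F = d})"
  have finK: "finite ?K" by (rule finite_all_edges[OF V])
  have finF: "finite \<F>" using finK V by (intro finite_subset[of \<F> "Pow ?K"]) (auto simp: \<F>_def)
  have star: "card {e \<in> ?K. x \<in> e} \<le> n" for x
  proof -
    have "deg ?K x = card (nbrs ?K x)" by (rule card_nbrs_all_edges[of ?K V, symmetric]) simp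
    also have "\<dots> \<le> card V" using nbrs_subset[of ?K V x] V by (intro card_mono) auto
    finally show ?thesis unfolding deg_def n_def .
  qed
  have "card \<F> \<le> (\<Sum>x\<in>V. card {F. F \<subseteq> {e \<in> ?K. x \<in> e} \<and> card F = d})"
    unfolding \<F>_def using V by (rule card_UN_le)
  also have "\<dots> = (\<Sum>x\<in>V. card {e \<in> ?K. x \<in> e} choose d)"
    using finK by (intro sum.cong n_subsets) auto
  also have "\<dots> \<le> (\<Sum>x\<in>V. n choose d)" using star by (intro sum_mono binomial_right_mono)
  finally have cardF: "real (card \<F>) \<le> real n * real (n choose d)"
    unfolding n_def by (metis of_nat_mono of_nat_mult sum_constant of_nat_id)
  have "{E. E \<subseteq> ?K \<and> (\<exists>x\<in>V. d \<le> deg E x)} \<subseteq> {E. \<exists>F\<in>\<F>. F \<subseteq> E}"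
  proof clarify
    fix E x assume E: "E \<subseteq> ?K" "x \<in> V" "d \<le> deg E x"
    obtain F where F: "F \<subseteq> {e \<in> E. x \<in> e}" "card F = d"
      by (rule obtain_subset_with_card_n[OF E(3)[unfolded deg_def]]) (rule that)
    then have "F \<in> \<F>" using E unfolding \<F>_def by blast
    then show "\<exists>F\<in>\<F>. F \<subseteq> E" using F(1) by blast
  qed
  then have "measure_pmf.prob ?R {E. E \<subseteq> ?K \<and> (\<exists>x\<in>V. d \<le> deg E x)}
      \<le> measure_pmf.prob ?R {E. \<exists>F\<in>\<F>. F \<subseteq> E}"
    by (intro measure_pmf.finite_measure_mono) auto
  also have "\<dots> \<le> card \<F> * p ^ d"
    by (rule union_bound_supersets[OF finK p finF]) (auto simp: \<F>_def)
  also have "\<dots> \<le> real n * (real (n choose d) * p ^ d)"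
    using mult_right_mono[OF cardF, of "p ^ d"] p by (simp add: mult.assoc)
  also have "real (n choose d) * p ^ d \<le> exp (- real d)"
  proof -
    have "real (n choose d) * fact d * (9 * p) ^ d \<le> real n ^ d * (9 * p) ^ d"
      using choose_mult_fact_le p by (intro mult_right_mono) auto
    also have "\<dots> = (9 * (real n * p)) ^ d" by (simp add: power_mult_distrib mult_ac)
    also have "\<dots> \<le> real d ^ d" using d(1) p unfolding n_def by (intro power_mono) auto
    also have "\<dots> \<le> 3 ^ d * fact d" by (rule self_power_le_fact)
    finally have "3 ^ d * (real (n choose d) * p ^ d * 3 ^ d) * fact d \<le> 3 ^ d * 1 * fact d"
      by (simp add: power_mult_distrib mult_ac flip: power_mult_distrib[of 3 3])
    then have "real (n choose d) * p ^ d * 3 ^ d \<le> 1"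
      by (simp add: mult_le_cancel_right mult_le_cancel_left)
    moreover have "real (n choose d) * p ^ d * exp (real d) \<le> real (n choose d) * p ^ d * 3 ^ d"
      using p exp_of_nat_le by (intro mult_left_mono) auto
    ultimately show ?thesis by (simp add: exp_minus field_simps)
  qed
  finally show ?thesis unfolding n_def by (simp add: mult_left_mono)
qed

lemma card_spanned_ge:
  assumes V: "finite V" and E: "E \<subseteq> all_edges V" and S: "S \<subseteq> V"
    and deg2: "\<And>x. x \<in> S \<Longrightarrow> 2 \<le> card {y \<in> S. {x, y} \<in> E}"
  shows "card S \<le> card {e \<in> E. e \<subseteq> S}"
proof -
  let ?E = "{e \<in> E. e \<subseteq> S}"
  have fin: "finite S" "finite ?E"
    using V S E finite_all_edges[OF V] by (auto intro: finite_subset)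
  have "2 \<le> deg ?E x" if "x \<in> S" for x
  proof -
    have "{y \<in> S. {x, y} \<in> E} = nbrs ?E x"
      using that unfolding nbrs_def by auto
    moreover have "card (nbrs ?E x) = deg ?E x" using E by (intro card_nbrs_all_edges) auto
    ultimately show ?thesis using deg2[OF that] by simp
  qed
  then have "(\<Sum>x\<in>S. 2) \<le> (\<Sum>x\<in>S. deg ?E x)" by (rule sum_mono)
  also have "\<dots> = 2 * card ?E" using fin E by (intro handshake) (auto simp: all_edges_def)
  finally show ?thesis by simp
qed

definition has_dense_set :: "'a set \<Rightarrow> 'a set set \<Rightarrow> bool" where
  "has_dense_set V E \<longleftrightarrow> (\<exists>S\<subseteq>V. S \<noteq> {} \<and> card S \<le> card {e \<in> E. e \<subseteq> S})"

text \<open>Union bound over vertex sets of size \<open>s\<close> together with \<open>s\<close> edges inside: there are at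
most \<open>(n choose s) * ((s * s) choose s)\<close> of these pairs, and both factors of \<open>fact s\<close>
in the denominator are needed to beat the power \<open>s ^ (2 * s)\<close>. A geometric series remains.\<close>

lemma prob_dense_set:
  fixes p :: real
  assumes V: "finite V" and p: "p \<in> {0..1}" and np: "9 * (real (card V) * p) \<le> 1 / 2"
  shows "measure_pmf.prob (random_subset (all_edges V) p)
      {E. E \<subseteq> all_edges V \<and> has_dense_set V E} \<le> 18 * (card V * p)"
proof -
  let ?K = "all_edges V"
  let ?R = "random_subset ?K p"
  define n where "n = card V"
  define \<F> where "\<F> s = (\<Union>S\<in>{S. S \<subseteq> V \<and> card S = s}. {F. F \<subseteq> all_edges S \<and> card F = s})" for s
  have finK: "finite ?K" by (rule finite_all_edges[OF V])
  have FK: "F \<subseteq> ?K \<and> card F = s" if "F \<in> \<F> s" for F s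
    using that unfolding \<F>_def all_edges_def by blast
  have finF: "finite (\<F> s)" for s using finK FK by (intro finite_subset[of "\<F> s" "Pow ?K"]) auto
  have cover: "{E. E \<subseteq> ?K \<and> has_dense_set V E} \<subseteq> (\<Union>s\<in>{1..n}. {E. \<exists>F\<in>\<F> s. F \<subseteq> E})"
  proof clarify
    fix E assume E: "E \<subseteq> ?K" "has_dense_set V E"
    then obtain S where S: "S \<subseteq> V" "S \<noteq> {}" "card S \<le> card {e \<in> E. e \<subseteq> S}"
      unfolding has_dense_set_def by blast
    obtain F where F: "F \<subseteq> {e \<in> E. e \<subseteq> S}" "card F = card S"
      by (rule obtain_subset_with_card_n[OF S(3)]) (rule that)
    have "F \<subseteq> all_edges S" using F(1) E(1) unfolding all_edges_def by auto
    then have "F \<in> \<F> (card S)" using S(1) F(2) unfolding \<F>_def by blast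
    moreover have "finite S" using S(1) V by (rule finite_subset)
    then have "card S \<in> {1..n}" using S V card_mono[of V S]
      unfolding n_def by (simp add: Suc_le_eq card_gt_0_iff)
    ultimately show "E \<in> (\<Union>s\<in>{1..n}. {E. \<exists>F\<in>\<F> s. F \<subseteq> E})" using F(1) by blast
  qed
  have bound: "real (card (\<F> s)) \<le> (9 * real n) ^ s" for s
  proof -
    have "card (\<F> s) \<le> (\<Sum>S\<in>{S. S \<subseteq> V \<and> card S = s}. card {F. F \<subseteq> all_edges S \<and> card F = s})"
      unfolding \<F>_def using V by (intro card_UN_le) auto
    also have "\<dots> \<le> (\<Sum>S\<in>{S. S \<subseteq> V \<and> card S = s}. (s * s) choose s)"
    proof (rule sum_mono)
      fix S assume "S \<in> {S. S \<subseteq> V \<and> card S = s}"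
      then have S: "finite S" "card S = s" using V finite_subset by auto
      have "card (all_edges S) = s choose 2"
        unfolding all_edges_def using n_subsets[OF S(1)] S(2) by simp
      also have "\<dots> \<le> s * s"
        unfolding choose_two using div_le_dividend order_trans by (metis diff_le_self mult_le_mono2)
      finally have "card (all_edges S) choose s \<le> (s * s) choose s" by (rule binomial_right_mono)
      then show "card {F. F \<subseteq> all_edges S \<and> card F = s} \<le> (s * s) choose s"
        using n_subsets[OF finite_all_edges[OF S(1)]] by simp
    qed
    also have "\<dots> = (n choose s) * ((s * s) choose s)"
      using n_subsets[OF V, of s] unfolding n_def by simp
    finally have "real (card (\<F> s)) \<le> real (n choose s) * real ((s * s) choose s)"
      by (metis of_nat_mono of_nat_mult)
    then have "real (card (\<F> s)) * (fact s * fact s)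
        \<le> (real (n choose s) * real ((s * s) choose s)) * (fact s * fact s)"
      by (rule mult_right_mono) simp
    also have "\<dots> = (real (n choose s) * fact s) * (real ((s * s) choose s) * fact s)" by simp
    also have "\<dots> \<le> real n ^ s * real (s * s) ^ s"
      by (intro mult_mono choose_mult_fact_le) auto
    also have "\<dots> = real n ^ s * (real s ^ s * real s ^ s)" by (simp add: power_mult_distrib)
    also have "\<dots> \<le> real n ^ s * ((3 ^ s * fact s) * (3 ^ s * fact s))"
      by (intro mult_left_mono mult_mono self_power_le_fact) auto
    also have "\<dots> = (9 * real n) ^ s * (fact s * fact s)"
      by (simp add: power_mult_distrib mult_ac flip: power_mult_distrib[of 3 3])
    finally show ?thesis by (simp add: mult_le_cancel_right)
  qed
  define q where "q = 9 * (real n * p)"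
  have q: "0 \<le> q" "q \<le> 1 / 2" using p np unfolding q_def n_def by auto
  have "measure_pmf.prob ?R {E. E \<subseteq> ?K \<and> has_dense_set V E}
      \<le> measure_pmf.prob ?R (\<Union>s\<in>{1..n}. {E. \<exists>F\<in>\<F> s. F \<subseteq> E})"
    using cover by (intro measure_pmf.finite_measure_mono) auto
  also have "\<dots> \<le> (\<Sum>s\<in>{1..n}. measure_pmf.prob ?R {E. \<exists>F\<in>\<F> s. F \<subseteq> E})"
    by (rule measure_UNION_le) auto
  also have "\<dots> \<le> (\<Sum>s\<in>{1..n}. q ^ s)"
  proof (rule sum_mono)
    fix s
    have "measure_pmf.prob ?R {E. \<exists>F\<in>\<F> s. F \<subseteq> E} \<le> card (\<F> s) * p ^ s"
      by (rule union_bound_supersets[OF finK p finF FK])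
    also have "\<dots> \<le> (9 * real n) ^ s * p ^ s" using bound p by (intro mult_right_mono) auto
    also have "\<dots> = q ^ s" by (simp add: q_def power_mult_distrib mult_ac)
    finally show "measure_pmf.prob ?R {E. \<exists>F\<in>\<F> s. F \<subseteq> E} \<le> q ^ s" .
  qed
  also have "\<dots> = q * (\<Sum>s<n. q ^ s)"
    by (simp add: sum_distrib_left sum.atLeast1_atMost_eq)
  also have "\<dots> \<le> q * 2"
  proof (rule mult_left_mono)
    have "(\<Sum>s<n. q ^ s) \<le> (\<Sum>s. q ^ s)" using q by (intro sum_le_suminf summable_geometric) auto
    also have "\<dots> = 1 / (1 - q)" using q by (intro suminf_geometric) auto
    also have "\<dots> \<le> 2" using q by (simp add: field_simps)
    finally show "(\<Sum>s<n. q ^ s) \<le> 2" .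
  qed (rule q)
  finally show ?thesis unfolding q_def n_def by simp
qed

text \<open>Both obstructions come from one set \<open>S\<close> of vertices of maximum degree with two neighbours in
\<open>S\<close> each. The first is unlikely when there are not too few edges, the second when there are
few edges.\<close>

lemma not_class_1_obstructions:
  assumes V: "finite V" "V \<noteq> {}" and E: "E \<subseteq> all_edges V" and n: "\<not> class_1 (V, E)"
  shows "adjacent_core V E" "has_dense_set V E"
proof -
  have "\<exists>S. S \<noteq> {} \<and> S \<subseteq> core V E \<and> (\<forall>x\<in>S. 2 \<le> card {y \<in> S. {x, y} \<in> E})"
  proof (rule ccontr)
    assume none: "\<not> ?thesis"
    have "class_1 (V, E)"
    proof (rule class_1_if_sparse_core[OF V])
      show "e \<subseteq> V \<and> card e = 2" if "e \<in> E" for e using that E unfolding all_edges_def by auto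
      fix S assume "S \<noteq> {}" "S \<subseteq> core V E"
      then obtain x where x: "x \<in> S" "\<not> 2 \<le> card {y \<in> S. {x, y} \<in> E}" using none by blast
      then have "card {y \<in> S. {x, y} \<in> E} \<le> 1" by linarith
      then show "\<exists>x\<in>S. card {y \<in> S. {x, y} \<in> E} \<le> 1" using x(1) by blast
    qed
    then show False using n by blast
  qed
  then obtain S where S: "S \<noteq> {}" "S \<subseteq> core V E" "\<And>x. x \<in> S \<Longrightarrow> 2 \<le> card {y \<in> S. {x, y} \<in> E}"
    by blast
  have SV: "S \<subseteq> V" using S(2) unfolding core_def by auto
  obtain x where x: "x \<in> S" using S(1) by auto
  then have "{y \<in> S. {x, y} \<in> E} \<noteq> {}" using S(3)[OF x] by force
  then show "adjacent_core V E" using x S(2) unfolding adjacent_core_def by blast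
  show "has_dense_set V E"
    unfolding has_dense_set_def using S(1) SV card_spanned_ge[OF V(1) E SV S(3)] by blast
qed

section \<open>The two ranges of the edge probability\<close>

lemma add_power4_le:
  fixes a b :: real
  shows "(a + b) ^ 4 \<le> 8 * (a ^ 4 + b ^ 4)"
proof -
  have sq: "(x + y)\<^sup>2 \<le> 2 * (x\<^sup>2 + y\<^sup>2)" for x y :: real
    using zero_le_power2[of "x - y"] by (simp add: power2_sum power2_diff)
  have "((a + b)\<^sup>2)\<^sup>2 \<le> (2 * (a\<^sup>2 + b\<^sup>2))\<^sup>2" using sq by (intro power_mono) auto
  also have "\<dots> = 4 * (a\<^sup>2 + b\<^sup>2)\<^sup>2" by (subst power_mult_distrib) simp
  also have "\<dots> \<le> 4 * (2 * ((a\<^sup>2)\<^sup>2 + (b\<^sup>2)\<^sup>2))" using sq[of "a\<^sup>2" "b\<^sup>2"] by linarith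
  finally show ?thesis by simp
qed

text \<open>In essence the bound is \<open>p * (D / (n * p)) ^ 4\<close>: the factor \<open>p\<close> is what the switch gains, and
for \<open>D\<close> of order \<open>n * p\<close> nothing else remains. The term \<open>b\<close> allows for a larger
maximum degree in sparser graphs.\<close>

lemma prob_adjacent_core_le:
  fixes p :: real
  assumes V: "finite V" and p: "0 < p" "p \<le> 1"
    and D: "real D + 4 \<le> card V / 2" "real D + 1 \<le> 9 * (card V * p) + b" and b: "0 \<le> b"
  shows "measure_pmf.prob (random_subset (all_edges V) p)
      {E. E \<subseteq> all_edges V \<and> adjacent_core V E \<and> (\<forall>x\<in>V. deg E x \<le> D)}
    \<le> 4608 * (6561 * p + b ^ 4 / (card V * (card V * p) ^ 3))"
proof -
  define n where "n = real (card V)"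
  define P where "P = measure_pmf.prob (random_subset (all_edges V) p)
      {E. E \<subseteq> all_edges V \<and> adjacent_core V E \<and> (\<forall>x\<in>V. deg E x \<le> D)}"
  have n: "0 < n" using D(1) unfolding n_def by linarith
  have "n / 2 \<le> real (card V - D - 4)" using D(1) unfolding n_def by linarith
  then have "(n / 2) ^ 4 \<le> real (card V - D - 4) ^ 4" using n by (intro power_mono) auto
  then have "p ^ 3 * (n / 2) ^ 4 * P \<le> p ^ 3 * real (card V - D - 4) ^ 4 * P"
    using p unfolding P_def by (intro mult_right_mono mult_left_mono) auto
  also have "\<dots> \<le> 36 * (real D + 1) ^ 4"
    unfolding P_def by (rule prob_adjacent_core[OF V p])
  also have "\<dots> \<le> 36 * (9 * (n * p) + b) ^ 4"
    using D(2) unfolding n_def by (intro mult_left_mono power_mono) auto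
  also have "\<dots> \<le> 36 * (8 * ((9 * (n * p)) ^ 4 + b ^ 4))"
    by (intro mult_left_mono add_power4_le) auto
  finally have "p ^ 3 * n ^ 4 * P \<le> 4608 * (6561 * (n * p) ^ 4 + b ^ 4)"
    by (simp add: power_divide power_mult_distrib)
  also have "\<dots> = p ^ 3 * n ^ 4 * (4608 * (6561 * p + b ^ 4 / (n * (n * p) ^ 3)))"
    using p n by (simp add: field_simps power_mult_distrib power4_eq_xxxx power3_eq_cube)
  finally show ?thesis using p n unfolding P_def n_def by simp
qed

text \<open>The two arguments overlap widely, and the threshold \<open>n powr (- 1 / 6)\<close> for \<open>n * p\<close> is one
convenient choice: below it dense sets are unlikely, and above it
\<open>n * (n * p) ^ 3\<close> exceeds \<open>sqrt n\<close>, which beats every power of the logarithm.\<close>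

lemma prob_not_class_1_le:
  fixes p :: real
  assumes p: "p \<in> {0..1}" and n: "1 \<le> n"
    and sparse: "9 * real n powr (- 1 / 6) \<le> 1 / 2"
    and D: "9 * (n * p) + 9 * ln n + 5 \<le> n / 2"
  shows "1 - measure_pmf.prob (gnp n p) {G. class_1 G}
    \<le> 18 * real n powr (- 1 / 6) + 1 / n + 4608 * (6561 * p + (9 * ln n + 2) ^ 4 / sqrt n)"
proof -
  define V where "V = {1..n}"
  define R where "R = random_subset (all_edges V) p"
  have V: "finite V" "V \<noteq> {}" "card V = n" using n unfolding V_def by auto
  define \<theta> where "\<theta> = real n powr (- 1 / 6)"
  have \<theta>: "0 < \<theta>" using n unfolding \<theta>_def by simp
  have ln: "0 \<le> ln (real n)" using n by simp
  have gnp: "gnp n p = map_pmf (Pair V) R"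
    unfolding gnp_def R_def random_subset_def map_pmf_comp V_def possible_edges_def all_edges_def by simp
  have "1 - measure_pmf.prob (gnp n p) {G. class_1 G} = 1 - measure_pmf.prob R {E. class_1 (V, E)}"
    unfolding gnp by (simp add: vimage_def)
  also have "\<dots> = measure_pmf.prob R (- {E. class_1 (V, E)})"
    using measure_pmf.prob_compl[of "{E. class_1 (V, E)}" R] by (simp add: Compl_eq_Diff_UNIV)
  also have "\<dots> = measure_pmf.prob R {E. E \<subseteq> all_edges V \<and> \<not> class_1 (V, E)}"
    using set_random_subset[of "all_edges V" p] unfolding R_def
    by (intro measure_prob_cong_0) (auto simp: set_pmf_iff)
  also have "\<dots> \<le> 18 * \<theta> + 1 / n + 4608 * (6561 * p + (9 * ln n + 2) ^ 4 / sqrt n)"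
  proof (cases "n * p \<le> \<theta>")
    case True
    have "measure_pmf.prob R {E. E \<subseteq> all_edges V \<and> \<not> class_1 (V, E)}
        \<le> measure_pmf.prob R {E. E \<subseteq> all_edges V \<and> has_dense_set V E}"
      using not_class_1_obstructions(2)[OF V(1,2)] by (intro measure_pmf.finite_measure_mono) auto
    also have "\<dots> \<le> 18 * (n * p)"
      using prob_dense_set[OF V(1) p] V(3) True sparse unfolding R_def \<theta>_def by simp
    also have "\<dots> \<le> 18 * \<theta>" using True by simp
    also have "\<dots> \<le> 18 * \<theta> + 1 / n + 4608 * (6561 * p + (9 * ln n + 2) ^ 4 / sqrt n)"
      using p ln by simp
    finally show ?thesis .
  next
    case False
    then have np: "\<theta> < n * p" by simp
    then have p0: "0 < p" using \<theta> n p by (cases "p = 0") auto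
    \<comment> \<open>With this bound the maximum degree exceeds \<open>D\<close> with probability at most \<open>n * exp (- 2 * ln n)\<close>,
      and the constant \<open>9\<close> is the one required by the union bound over stars.\<close>
    define D where "D = nat \<lceil>9 * (n * p) + 9 * ln n\<rceil>"
    have D1: "9 * (n * p) + 9 * ln n \<le> real D" "real D \<le> 9 * (n * p) + 9 * ln n + 1"
    proof -
      have "0 \<le> 9 * (n * p) + 9 * ln n" using p ln by simp
      then show "9 * (n * p) + 9 * ln n \<le> real D" "real D \<le> 9 * (n * p) + 9 * ln n + 1"
        unfolding D_def by linarith+
    qed
    let ?high = "{E. E \<subseteq> all_edges V \<and> (\<exists>x\<in>V. D + 1 \<le> deg E x)}"
    let ?adj = "{E. E \<subseteq> all_edges V \<and> adjacent_core V E \<and> (\<forall>x\<in>V. deg E x \<le> D)}"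
    have "{E. E \<subseteq> all_edges V \<and> \<not> class_1 (V, E)} \<subseteq> ?high \<union> ?adj"
      using not_class_1_obstructions(1)[OF V(1,2)] by (auto simp: not_le Suc_le_eq)
    then have "measure_pmf.prob R {E. E \<subseteq> all_edges V \<and> \<not> class_1 (V, E)}
        \<le> measure_pmf.prob R (?high \<union> ?adj)" by (intro measure_pmf.finite_measure_mono) auto
    also have "\<dots> \<le> measure_pmf.prob R ?high + measure_pmf.prob R ?adj"
      by (rule measure_Un_le) auto
    also have "measure_pmf.prob R ?high \<le> 1 / n"
    proof -
      have "measure_pmf.prob R ?high \<le> n * exp (- real (D + 1))"
        using prob_max_degree_ge[OF V(1) p, of "D + 1"] D1(1) V(3) ln unfolding R_def by simp
      also have "\<dots> \<le> n * exp (- (ln n + ln n))"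
      proof -
        have "0 \<le> n * p" using p by simp
        then have "ln n + ln n \<le> real (D + 1)" using D1(1) ln by simp
        then show ?thesis by (intro mult_left_mono) auto
      qed
      also have "\<dots> = 1 / n" using n by (simp only: exp_minus exp_add) (simp add: field_simps)
      finally show ?thesis .
    qed
    also have "measure_pmf.prob R ?adj \<le> 4608 * (6561 * p + (9 * ln n + 2) ^ 4 / (n * (n * p) ^ 3))"
      using prob_adjacent_core_le[OF V(1) p0, of D "9 * ln n + 2"] D D1 V(3) ln p
      unfolding R_def by simp
    also have "(9 * ln n + 2) ^ 4 / (n * (n * p) ^ 3) \<le> (9 * ln n + 2) ^ 4 / sqrt n"
    proof (rule divide_left_mono)
      have "sqrt n = n powr (1 / 2)" using n by (simp add: powr_half_sqrt)
      also have "\<dots> = n powr (1 + - 1 / 2)" by simp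
      also have "\<dots> = n powr 1 * n powr (- 1 / 2)" by (rule powr_add)
      also have "n powr (- 1 / 2) = \<theta> ^ 3" using n by (simp add: \<theta>_def powr_power)
      also have "n powr 1 * \<theta> ^ 3 \<le> n * (n * p) ^ 3"
        using np \<theta> n by (simp add: power_mono)
      finally show "sqrt n \<le> n * (n * p) ^ 3" .
    qed (use n p0 in auto)
    finally show ?thesis using \<theta> by simp
  qed
  finally show ?thesis unfolding \<theta>_def .
qed

theorem theorem1p3:
  fixes p :: "nat \<Rightarrow> real"
  assumes "\<And>n. n \<ge> 1 \<Longrightarrow> p n \<in> {0..1}"
    and "p \<in> o(\<lambda>_. 1)"
  shows "(\<lambda>n. measure_pmf.prob (gnp n (p n)) {G. class_1 G}) \<longlonglongrightarrow> 1"
proof -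
  let ?f = "\<lambda>n. measure_pmf.prob (gnp n (p n)) {G. class_1 G}"
  let ?err = "\<lambda>n. 18 * real n powr (- 1 / 6) + 1 / n
    + 4608 * (6561 * p n + (9 * ln n + 2) ^ 4 / sqrt n)"
  have p0: "p \<longlonglongrightarrow> 0" using smalloD_tendsto[OF assms(2)] by simp
  have lims: "(\<lambda>n. 18 * real n powr (- 1 / 6)) \<longlonglongrightarrow> 0" "(\<lambda>n. 1 / real n) \<longlonglongrightarrow> 0"
    "(\<lambda>n. (9 * ln (real n) + 2) ^ 4 / sqrt (real n)) \<longlonglongrightarrow> 0"
    by real_asymp+
  have err: "?err \<longlonglongrightarrow> 0"
    using tendsto_add[OF tendsto_add[OF lims(1,2)] tendsto_mult[OF tendsto_const[of 4608]
      tendsto_add[OF tendsto_mult[OF tendsto_const[of 6561] p0] lims(3)]]] by simp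
  have "eventually (\<lambda>n. p n < 1 / 36) sequentially" using p0 by (rule order_tendstoD) simp
  moreover have "eventually (\<lambda>n. 9 * real n powr (- 1 / 6) \<le> 1 / 2) sequentially"
    "eventually (\<lambda>n. 9 * ln (real n) + 5 \<le> real n / 4) sequentially"
    by real_asymp+
  moreover have "eventually (\<lambda>n::nat. n \<ge> 1) sequentially" by (rule eventually_ge_at_top)
  ultimately have lower: "eventually (\<lambda>n. 1 - ?err n \<le> ?f n) sequentially"
  proof eventually_elim
    case (elim n)
    have "real n * p n \<le> real n * (1 / 36)" using elim(1) by (intro mult_left_mono) auto
    then have "9 * (n * p n) + 9 * ln n + 5 \<le> n / 2" using elim(3) by linarith
    from prob_not_class_1_le[OF assms(1)[OF elim(4)] elim(4,2) this] show ?case by linarith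
  qed
  have upper: "eventually (\<lambda>n. ?f n \<le> 1) sequentially" by (simp add: measure_pmf.prob_le_1)
  have "(\<lambda>n. 1 - ?err n) \<longlonglongrightarrow> 1" using tendsto_diff[OF tendsto_const err, of 1] by simp
  from tendsto_sandwich[OF lower upper this tendsto_const] show ?thesis .
qed

end
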